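(* Let $G$ be a graph and let $S_0=\{F_1,F_2,\ldots,F_k\}$ be a family of non-separable graphs, some of them possibly isomorphic (a graph type). Then $$\left[\begin{array}{c} G \\ S_0 \end{array}\right]=\sum_{S_q\prec S_{q-1}\prec\cdots\prec S_0}\frac{(-1)^q\,p(S_q)\,\prod_{i=0}^{q-1}c(S_i,S_{i+1})}{\prod_{i=0}^{q}c(S_i,S_i)},$$ where the summation is over all chains $S_q\prec S_{q-1}\prec\cdots\prec S_0$ of graph types with $q\ge 0$, and an empty product is $1$.
   Context: All graphs are finite and simple. A graph $H$ with vertex set $VH$ is separable if there exists $K\subsetneq VH$ with $|K|\le 1$ such that $H-K$ is disconnected, and non-separable otherwise. The type of a graph is determined by the number of its blocks of each isomorphism type; thus a family $S=\{F_1,\dots,F_k\}$ of non-separable graphs, some of them possibly isomorphic, represents a graph type. For a graph $F$, $\left[\begin{array}{c} G \\ F \end{array}\right]$ is the number of (not necessarily induced) subgraphs of $G$ isomorphic to $F$; for a type $S$, $\left[\begin{array}{c} G \\ S \end{array}\right]$ is the number of subgraphs of $G$ of type $S$. For a type $S=\{F_1,\dots,F_k\}$, $p(S)=\prod_{i=1}^k\left[\begin{array}{c} G \\ F_i \end{array}\right]$. For a graph $X$, $c(S,X)$ is the number of tuples $(X_1,\dots,X_k)$ of subgraphs of $X$ such that $X_i\cong F_i$ for all $i$ and $\bigcup_{i=1}^k X_i=X$. The number $c(S,X)$ is taken to depend only on the type $S'$ of $X$, not on the particular choice of $X$, and is written $c(S,S')$. The partial order $\preceq$ on graph types is defined by: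 $S'\preceq S$ if $c(S,X)$ is non-zero for some graph $X$ of type $S'$; $S'\prec S$ means $S'\preceq S$ and $S'\neq S$.
   Formalization: If some F_i is a single vertex, c(S_i,X) is assumed to depend only on the type of X for all types S_i in the chains; this can fail (S={K1,K2,K2}: 6 for the path P3, 8 for 2K2), leaving c(S,S') undefined. With no single-vertex F_i it is proved. *)

theory Defs
  imports Complex_Main "HOL-Library.Multiset"
begin

section \<open>Finite simple graphs\<close>

text \<open>A graph is a pair of a vertex set and a set of two-element sets of vertices. The vertex set
  may be empty.\<close>

type_synonym 'a ugraph = "'a set \<times> 'a set set"

abbreviation verts :: "'a ugraph \<Rightarrow> 'a set" where "verts \<equiv> fst"
abbreviation edges :: "'a ugraph \<Rightarrow> 'a set set" where "edges \<equiv> snd"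

definition simple_graph :: "'a ugraph \<Rightarrow> bool" where
  "simple_graph G \<longleftrightarrow> finite (verts G) \<and> (\<forall>e\<in>edges G. e \<subseteq> verts G \<and> card e = 2)"

definition subgraph :: "'a ugraph \<Rightarrow> 'a ugraph \<Rightarrow> bool" where
  "subgraph H G \<longleftrightarrow> simple_graph H \<and> verts H \<subseteq> verts G \<and> edges H \<subseteq> edges G"

definition isomorphic :: "'a ugraph \<Rightarrow> 'b ugraph \<Rightarrow> bool" where
  "isomorphic G H \<longleftrightarrow>
     (\<exists>f. bij_betw f (verts G) (verts H) \<and> edges H = (\<lambda>e. f ` e) ` edges G)"

definition del_verts :: "'a ugraph \<Rightarrow> 'a set \<Rightarrow> 'a ugraph" where
  "del_verts H K = (verts H - K, {e \<in> edges H. e \<inter> K = {}})"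

definition connected_graph :: "'a ugraph \<Rightarrow> bool" where
  "connected_graph G \<longleftrightarrow> (\<forall>u\<in>verts G. \<forall>v\<in>verts G. (u, v) \<in> {(x, y). {x, y} \<in> edges G}\<^sup>*)"

definition separable :: "'a ugraph \<Rightarrow> bool" where
  "separable H \<longleftrightarrow> (\<exists>K. K \<subset> verts H \<and> card K \<le> 1 \<and> \<not> connected_graph (del_verts H K))"

text \<open>A block is a maximal non-separable subgraph. An isolated vertex is a block, and the graph
  without vertices is its own unique block.\<close>

definition blocks :: "'a ugraph \<Rightarrow> 'a ugraph set" where
  "blocks G = {B. subgraph B G \<and> \<not> separable B \<and>
     (\<forall>B'. subgraph B' G \<and> \<not> separable B' \<and> subgraph B B' \<longrightarrow> B' = B)}"


section \<open>Graph types\<close>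

text \<open>Every finite graph is isomorphic to one with vertices in \<^typ>\<open>nat\<close>, so isomorphism classes of
  graphs over arbitrary vertex types are represented by sets of graphs on natural numbers.\<close>

type_synonym gtype = "nat ugraph set multiset"

definition iso_class :: "'a ugraph \<Rightarrow> nat ugraph set" where
  "iso_class F = {H. simple_graph H \<and> isomorphic H F}"

definition family_type :: "'a ugraph list \<Rightarrow> gtype" where
  "family_type Fs = mset (map iso_class Fs)"

definition graph_type :: "'a ugraph \<Rightarrow> gtype" where
  "graph_type G = image_mset iso_class (mset_set (blocks G))"

text \<open>A family representing a given type. The quantities below that are defined through it depend
  neither on the order of its members nor on their choice within the isomorphism classes.\<close>

definition repr_family :: "gtype \<Rightarrow> nat ugraph list" where
  "repr_family S = (SOME Fs. (\<forall>F\<in>set Fs. simple_graph F) \<and> family_type Fs = S)"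


section \<open>Counting subgraphs\<close>

definition num_copies :: "'a ugraph \<Rightarrow> 'b ugraph \<Rightarrow> nat" where
  "num_copies G F = card {H. subgraph H G \<and> isomorphic H F}"

definition num_of_type :: "'a ugraph \<Rightarrow> gtype \<Rightarrow> nat" where
  "num_of_type G S = card {H. subgraph H G \<and> graph_type H = S}"

definition p :: "'a ugraph \<Rightarrow> gtype \<Rightarrow> nat" where
  "p G S = (\<Prod>F\<leftarrow>repr_family S. num_copies G F)"

definition union_graph :: "'a ugraph list \<Rightarrow> 'a ugraph" where
  "union_graph Xs = (\<Union>H\<in>set Xs. verts H, \<Union>H\<in>set Xs. edges H)"

definition cover_tuples :: "'b ugraph list \<Rightarrow> 'a ugraph \<Rightarrow> 'a ugraph list set" where
  "cover_tuples Fs X =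
     {Xs. list_all2 (\<lambda>H F. subgraph H X \<and> isomorphic H F) Xs Fs \<and> union_graph Xs = X}"

definition c_graph :: "gtype \<Rightarrow> 'a ugraph \<Rightarrow> nat" where
  "c_graph S X = card (cover_tuples (repr_family S) X)"

text \<open>That \<open>c(S,X)\<close> depends only on the type of \<open>X\<close>. This can fail if a member of \<open>S\<close> is a single
  vertex: for \<open>S = {K\<^sub>1, K\<^sub>2, K\<^sub>2}\<close> the path with two edges and the graph consisting of two disjoint
  edges have the same type \<open>{K\<^sub>2, K\<^sub>2}\<close>, but \<open>c(S,X)\<close> is 6 for the former and 8 for the latter.\<close>

definition c_type_invariant :: "gtype \<Rightarrow> bool" where
  "c_type_invariant S \<longleftrightarrow>
     (\<forall>(X :: nat ugraph) (X' :: nat ugraph).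
        simple_graph X \<and> simple_graph X' \<and> graph_type X = graph_type X' \<longrightarrow>
        c_graph S X = c_graph S X')"

text \<open>The common value of \<open>c(S,X)\<close> over the graphs \<open>X\<close> of type \<open>S'\<close>, and 0 if there is no graph of
  type \<open>S'\<close> (for example, if \<open>S'\<close> consists of \<open>K\<^sub>2\<close> and the graph without vertices).\<close>

definition c :: "gtype \<Rightarrow> gtype \<Rightarrow> nat" where
  "c S S' =
     (if \<exists>X :: nat ugraph. simple_graph X \<and> graph_type X = S'
      then c_graph S (SOME X :: nat ugraph. simple_graph X \<and> graph_type X = S')
      else 0)"


section \<open>The order on graph types and its chains\<close>

definition type_le :: "gtype \<Rightarrow> gtype \<Rightarrow> bool" (infix "\<preceq>" 50) where
  "S' \<preceq> S \<longleftrightarrow> (\<exists>X :: nat ugraph. simple_graph X \<and> graph_type X = S' \<and> c_graph S X \<noteq> 0)"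

definition type_less :: "gtype \<Rightarrow> gtype \<Rightarrow> bool" (infix "\<prec>" 50) where
  "S' \<prec> S \<longleftrightarrow> S' \<preceq> S \<and> S' \<noteq> S"

text \<open>The chain \<open>S\<^sub>q \<prec> \<dots> \<prec> S\<^sub>1 \<prec> S\<^sub>0\<close> is encoded as the list \<open>[S\<^sub>0, S\<^sub>1, \<dots>, S\<^sub>q]\<close>.\<close>

definition type_chains :: "gtype \<Rightarrow> gtype list set" where
  "type_chains S0 =
     {Ss. Ss \<noteq> [] \<and> Ss ! 0 = S0 \<and> (\<forall>i. Suc i < length Ss \<longrightarrow> Ss ! Suc i \<prec> Ss ! i)}"

definition chain_term :: "'a ugraph \<Rightarrow> gtype list \<Rightarrow> real" where
  "chain_term G Ss =
     (let q = length Ss - 1 in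
        (-1) ^ q * real (p G (Ss ! q)) * (\<Prod>i<q. real (c (Ss ! i) (Ss ! Suc i)))
        / (\<Prod>i\<le>q. real (c (Ss ! i) (Ss ! i))))"

end

theory Submission
  imports Defs
begin

text \<open>Sorting the tuples of copies of the members of \<open>S\<close> in \<open>G\<close> by their union gives
  \<open>p(S) = \<Sum> c(S,S') [G choose S']\<close>, summed over the types \<open>S' \<preceq> S\<close>. Since \<open>c(S,S) \<noteq> 0\<close>, this can be
  solved for \<open>[G choose S]\<close>, and the chain formula results from iterating. The iteration terminates
  because \<open>S' \<prec> S\<close> implies that \<open>S'\<close> has fewer blocks than \<open>S\<close>: a graph covered by non-separable
  subgraphs has at most as many blocks as there are subgraphs, and if the numbers agree, then the
  subgraphs are the blocks. A type \<open>S\<^sub>0\<close> that no graph has makes both sides 0.\<close>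

section \<open>Isomorphisms\<close>

text \<open>Sorting covers by type needs \<open>c_graph S X\<close> to depend on \<open>X\<close>
  only through its type. A type records the blocks of a graph but not how they are glued at cut
  vertices, and a member that is a single vertex can detect the gluing through the number of
  vertices. Other non-separable members cannot: they are spanned by their edges and lie inside one
  block, so a bijection of edges assembled block by block carries covers of one graph to covers of
  any other graph of the same type. Hence the alternative in the theorem: either no member is a
  single vertex, a condition inherited along \<prec>, or invariance is assumed for the types in the
  chains. Both the edge bijection and the comparison of block numbers rest on one fact: distinct
  blocks share no edge. Since types are compared through graphs on natural numbers, all notions must
  also be carried along injective maps of vertices.\<close>

definition map_graph :: "('a \<Rightarrow> 'b) \<Rightarrow> 'a ugraph \<Rightarrow> 'b ugraph" where
  "map_graph f H = (f ` verts H, (\<lambda>e. f ` e) ` edges H)"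

lemma verts_map_graph [simp]: "verts (map_graph f H) = f ` verts H"
  and edges_map_graph [simp]: "edges (map_graph f H) = (\<lambda>e. f ` e) ` edges H"
  by (simp_all add: map_graph_def)

text \<open>Writing an isomorphism as an image turns composition and inversion into equations
  between graphs. Injectivity on the vertices suffices, so one map on an ambient graph serves all
  its subgraphs.\<close>

lemma isomorphic_iff_map_graph:
  "isomorphic G H \<longleftrightarrow> (\<exists>f. inj_on f (verts G) \<and> H = map_graph f G)"
  by (auto simp: isomorphic_def bij_betw_def prod_eq_iff)

lemma map_graph_comp: "map_graph g (map_graph f G) = map_graph (g \<circ> f) G"
  by (simp add: map_graph_def image_comp image_image)

lemma simple_graph_edgeD:
  assumes "simple_graph G" "e \<in> edges G"
  shows "e \<subseteq> verts G" "card e = 2"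
  using assms by (auto simp: simple_graph_def)

lemma simple_graph_finite_verts: "simple_graph G \<Longrightarrow> finite (verts G)"
  by (simp add: simple_graph_def)

lemma simple_graph_finite_edges: "simple_graph G \<Longrightarrow> finite (edges G)"
  by (rule finite_subset[of _ "Pow (verts G)"]) (auto simp: simple_graph_def)

lemma subgraph_simple: "subgraph H G \<Longrightarrow> simple_graph H"
  by (simp add: subgraph_def)

lemma subgraph_refl: "simple_graph G \<Longrightarrow> subgraph G G"
  by (simp add: subgraph_def)

lemma subgraph_trans: "subgraph H K \<Longrightarrow> subgraph K G \<Longrightarrow> subgraph H G"
  by (auto simp: subgraph_def)

lemma subgraph_antisym: "subgraph H K \<Longrightarrow> subgraph K H \<Longrightarrow> H = K"
  by (auto simp: subgraph_def prod_eq_iff)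

lemma finite_subgraphs:
  assumes "simple_graph G"
  shows "finite {H. subgraph H G}"
proof (rule finite_subset)
  show "{H. subgraph H G} \<subseteq> Pow (verts G) \<times> Pow (edges G)"
    by (auto simp: subgraph_def)
qed (simp add: assms simple_graph_finite_verts simple_graph_finite_edges)

section \<open>Transport of graphs and subgraphs along injective maps\<close>

lemma map_graph_ident:
  assumes "simple_graph G" "\<And>x. x \<in> verts G \<Longrightarrow> f x = x"
  shows "map_graph f G = G"
proof -
  have "f ` e = e" if "e \<subseteq> verts G" for e
    using that assms(2) by (force simp: subset_iff)
  then show ?thesis
    using simple_graph_edgeD(1)[OF assms(1)] by (simp add: prod_eq_iff)
qed

lemma simple_map_graph:
  assumes "simple_graph G" "inj_on f (verts G)"
  shows "simple_graph (map_graph f G)"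
proof -
  have "card (f ` e) = 2" if "e \<in> edges G" for e
    using simple_graph_edgeD[OF assms(1) that] assms(2) by (metis card_image inj_on_subset)
  then show ?thesis using assms by (auto simp: simple_graph_def)
qed

lemma map_graph_inv:
  assumes "subgraph H G" "inj_on f (verts G)"
  shows "map_graph (inv_into (verts G) f) (map_graph f H) = H"
  unfolding map_graph_comp using assms by (intro map_graph_ident) (auto simp: subgraph_def)

lemma inj_on_map_graph:
  assumes "inj_on f (verts G)"
  shows "inj_on (map_graph f) {H. subgraph H G}"
  by (rule inj_on_inverseI[where g = "map_graph (inv_into (verts G) f)"])
     (simp add: map_graph_inv assms)

lemma subgraph_map_graph:
  assumes "subgraph H G" "inj_on f (verts G)"
  shows "subgraph (map_graph f H) (map_graph f G)"
  using assms unfolding subgraph_def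
  by (auto intro!: simple_map_graph intro: inj_on_subset)

lemma inj_on_inv_into_map_graph: "inj_on (inv_into (verts G) f) (verts (map_graph f G))"
  by (simp add: inj_on_inv_into)

text \<open>A subgraph of the image is pulled back along \<open>inv_into (verts G) f\<close>.
  Notions expressed through subgraphs, such as blocks and covering tuples, are carried over by this
  correspondence.\<close>

lemma subgraphs_map_graph:
  assumes "simple_graph G" "inj_on f (verts G)"
  shows "{H'. subgraph H' (map_graph f G)} = map_graph f ` {H. subgraph H G}"
proof (intro equalityI subsetI)
  fix H' assume "H' \<in> {H'. subgraph H' (map_graph f G)}"
  then have H': "subgraph H' (map_graph f G)" by simp
  let ?g = "inv_into (verts G) f"
  have "subgraph (map_graph ?g H') (map_graph ?g (map_graph f G))"
    using H' inj_on_inv_into_map_graph by (rule subgraph_map_graph)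
  then have "subgraph (map_graph ?g H') G"
    by (simp add: map_graph_inv assms subgraph_refl)
  moreover have "map_graph f (map_graph ?g H') = H'"
    unfolding map_graph_comp using H'
    by (intro map_graph_ident) (auto simp: subgraph_def f_inv_into_f subset_iff)
  ultimately show "H' \<in> map_graph f ` {H. subgraph H G}" by force
next
  fix H' assume "H' \<in> map_graph f ` {H. subgraph H G}"
  then show "H' \<in> {H'. subgraph H' (map_graph f G)}"
    using subgraph_map_graph[OF _ assms(2)] by blast
qed

lemma subgraph_map_graph_iff:
  assumes "subgraph H G" "subgraph K G" "inj_on f (verts G)"
  shows "subgraph (map_graph f H) (map_graph f K) \<longleftrightarrow> subgraph H K"
proof
  assume "subgraph (map_graph f H) (map_graph f K)"
  have "subgraph (map_graph (inv_into (verts G) f) (map_graph f H))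
      (map_graph (inv_into (verts G) f) (map_graph f K))"
    using \<open>subgraph (map_graph f H) (map_graph f K)\<close>
    by (rule subgraph_map_graph) (use assms(2) in \<open>auto simp: subgraph_def intro!: inj_on_inv_into\<close>)
  then show "subgraph H K" by (simp add: map_graph_inv assms)
next
  assume "subgraph H K"
  then show "subgraph (map_graph f H) (map_graph f K)"
    using assms by (intro subgraph_map_graph) (auto simp: subgraph_def intro: inj_on_subset)
qed

section \<open>Isomorphism as an equivalence relation and its classes\<close>

lemma isomorphic_refl: "simple_graph G \<Longrightarrow> isomorphic G G"
  unfolding isomorphic_iff_map_graph by (metis inj_on_id id_apply map_graph_ident)

text \<open>The inverse map restores the edges only if they lie in the vertex set, outside which
  \<open>f\<close> is arbitrary; hence the hypothesis \<open>simple_graph G\<close>.\<close>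

lemma isomorphic_sym:
  assumes "isomorphic G H" "simple_graph G"
  shows "isomorphic H G"
proof -
  obtain f where f: "inj_on f (verts G)" "H = map_graph f G"
    using assms by (auto simp: isomorphic_iff_map_graph)
  have "map_graph (inv_into (verts G) f) H = G"
    by (simp add: f map_graph_inv assms subgraph_refl)
  then show ?thesis
    unfolding isomorphic_iff_map_graph using inj_on_inv_into_map_graph f(2) by metis
qed

lemma isomorphic_trans:
  assumes "isomorphic G H" "isomorphic H K"
  shows "isomorphic G K"
proof -
  obtain f g where f: "inj_on f (verts G)" "H = map_graph f G"
    and g: "inj_on g (verts H)" "K = map_graph g H"
    using assms by (auto simp: isomorphic_iff_map_graph)
  then have "inj_on (g \<circ> f) (verts G)" by (intro comp_inj_on) auto
  then show ?thesis
    unfolding isomorphic_iff_map_graph using f g by (auto simp: map_graph_comp)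
qed

lemma isomorphic_simple: "isomorphic G H \<Longrightarrow> simple_graph G \<Longrightarrow> simple_graph H"
  unfolding isomorphic_iff_map_graph using simple_map_graph by blast

lemma isomorphic_map_graph:
  assumes "subgraph H G" "inj_on f (verts G)"
  shows "isomorphic H (map_graph f H)"
  unfolding isomorphic_iff_map_graph
  using assms by (auto simp: subgraph_def intro: inj_on_subset)

lemma isomorphic_map_graph_iff:
  assumes "subgraph H G" "inj_on f (verts G)"
  shows "isomorphic (map_graph f H) F \<longleftrightarrow> isomorphic H F"
  using isomorphic_map_graph[OF assms] assms(1)
  by (metis isomorphic_sym isomorphic_trans subgraph_simple)

lemma isomorphic_card_verts: "isomorphic G H \<Longrightarrow> card (verts G) = card (verts H)"
  unfolding isomorphic_def by (metis bij_betw_same_card)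

text \<open>The image is an initial segment so that graphs with a bounded number of vertices have
  copies in one finite set of graphs.\<close>

lemma ex_nat_copy:
  assumes "simple_graph G"
  obtains f :: "'a \<Rightarrow> nat" where "inj_on f (verts G)" "f ` verts G = {..<card (verts G)}"
  using assms ex_bij_betw_finite_nat[of "verts G"]
  by (auto simp: simple_graph_finite_verts bij_betw_def lessThan_atLeast0)

text \<open>The two graphs may have different vertex types; a copy of \<open>F\<close> on natural
  numbers lies in the common class and links them.\<close>

lemma iso_class_eq_iff:
  assumes "simple_graph F" "simple_graph F'"
  shows "iso_class F = iso_class F' \<longleftrightarrow> isomorphic F F'"
proof
  assume eq: "iso_class F = iso_class F'"
  obtain f :: "'a \<Rightarrow> nat" where f: "inj_on f (verts F)"
    using ex_nat_copy[OF assms(1)] by blast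
  have iso: "isomorphic F (map_graph f F)"
    using f assms(1) by (intro isomorphic_map_graph) (auto simp: subgraph_refl)
  then have "map_graph f F \<in> iso_class F"
    using f assms by (simp add: iso_class_def simple_map_graph isomorphic_sym)
  then have "isomorphic (map_graph f F) F'"
    unfolding eq by (simp add: iso_class_def)
  then show "isomorphic F F'" using iso isomorphic_trans by blast
next
  assume "isomorphic F F'"
  then show "iso_class F = iso_class F'"
    using assms by (auto simp: iso_class_def intro: isomorphic_trans isomorphic_sym)
qed


section \<open>Non-separable graphs and blocks\<close>

lemma del_verts_empty [simp]: "del_verts H {} = H"
  by (simp add: del_verts_def)

lemma connected_map_graph:
  assumes "connected_graph H"
  shows "connected_graph (map_graph f H)"
proof -
  have "(f u, f v) \<in> {(x, y). {x, y} \<in> edges (map_graph f H)}\<^sup>*"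
    if "(u, v) \<in> {(x, y). {x, y} \<in> edges H}\<^sup>*" for u v
    using that
  proof (induction rule: rtrancl_induct)
    case (step y z)
    have "{f y, f z} \<in> edges (map_graph f H)"
      using step.hyps(2) by (auto intro!: image_eqI[of _ _ "{y, z}"])
    then show ?case by (intro rtrancl.rtrancl_into_rtrancl[OF step.IH]) simp
  qed simp
  then show ?thesis using assms by (auto simp: connected_graph_def)
qed

lemma del_verts_map_graph:
  assumes "simple_graph G" "inj_on f (verts G)" "K \<subseteq> verts G"
  shows "del_verts (map_graph f G) (f ` K) = map_graph f (del_verts G K)"
proof -
  have "f ` e \<inter> f ` K = {} \<longleftrightarrow> e \<inter> K = {}" if "e \<in> edges G" for e
    using assms simple_graph_edgeD(1)[OF assms(1) that]
    by (metis image_is_empty inj_on_image_Int)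
  moreover have "f ` verts G - f ` K = f ` (verts G - K)"
    using assms(2,3) by (metis inj_on_image_set_diff Diff_subset order_refl)
  ultimately show ?thesis by (auto simp: del_verts_def map_graph_def)
qed

lemma nonseparable_map_graph:
  assumes "simple_graph G" "inj_on f (verts G)" "\<not> separable G"
  shows "\<not> separable (map_graph f G)"
proof
  assume "separable (map_graph f G)"
  then obtain K' where K': "K' \<subset> f ` verts G" "card K' \<le> 1"
    and dis: "\<not> connected_graph (del_verts (map_graph f G) K')"
    by (auto simp: separable_def)
  obtain K where K: "K \<subseteq> verts G" "K' = f ` K"
    using K'(1) by (metis psubset_imp_subset subset_imageE)
  have "card K \<le> 1" using K K'(2) assms(2) by (metis card_image inj_on_subset)
  moreover have "K \<subset> verts G" using K K' by blast
  ultimately have "connected_graph (del_verts G K)"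
    using assms(3) by (auto simp: separable_def)
  then show False
    using dis K connected_map_graph by (metis assms(1,2) del_verts_map_graph)
qed

lemma isomorphic_nonseparable:
  assumes "isomorphic G H" "simple_graph G" "\<not> separable G"
  shows "\<not> separable H"
  using assms unfolding isomorphic_iff_map_graph by (metis nonseparable_map_graph)

lemma separable_map_graph_iff:
  assumes "subgraph H G" "inj_on f (verts G)"
  shows "separable (map_graph f H) \<longleftrightarrow> separable H"
  using isomorphic_map_graph[OF assms] assms(1)
  by (meson isomorphic_nonseparable isomorphic_simple isomorphic_sym subgraph_simple)

lemma blocks_map_graph:
  assumes "simple_graph G" "inj_on f (verts G)"
  shows "blocks (map_graph f G) = map_graph f ` blocks G"
proof -
  let ?S = "{H. subgraph H G}"
  have S: "{H'. subgraph H' (map_graph f G)} = map_graph f ` ?S"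
    using assms by (rule subgraphs_map_graph)
  \<comment> \<open>With the maximality quantifier bounded by the set of subgraphs,
    \<open>blocks\<close> can be rewritten along the correspondence \<open>S\<close>.\<close>
  have blocks: "blocks K = {B \<in> {H. subgraph H K}. \<not> separable B \<and>
      (\<forall>B' \<in> {H. subgraph H K}. \<not> separable B' \<and> subgraph B B' \<longrightarrow> B' = B)}"
    for K :: "'c ugraph"
    unfolding blocks_def by blast
  have "map_graph f B \<in> blocks (map_graph f G) \<longleftrightarrow> B \<in> blocks G" if "B \<in> ?S" for B
    using that assms inj_on_map_graph[OF assms(2)] unfolding blocks S
    by (auto simp: separable_map_graph_iff subgraph_map_graph_iff inj_on_eq_iff
        subgraph_map_graph)
  moreover have "blocks (map_graph f G) \<subseteq> map_graph f ` ?S" "blocks G \<subseteq> ?S"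
    using S by (auto simp: blocks_def)
  ultimately show ?thesis by blast
qed

lemma finite_blocks: "simple_graph G \<Longrightarrow> finite (blocks G)"
  by (rule finite_subset[OF _ finite_subgraphs]) (auto simp: blocks_def)

lemma graph_type_map_graph:
  assumes "simple_graph G" "inj_on f (verts G)"
  shows "graph_type (map_graph f G) = graph_type G"
proof -
  have inj: "inj_on (map_graph f) (blocks G)"
    using inj_on_map_graph[OF assms(2)] by (rule inj_on_subset) (auto simp: blocks_def)
  have "iso_class (map_graph f B) = iso_class B" if "B \<in> blocks G" for B
  proof -
    have B: "subgraph B G" using that by (simp add: blocks_def)
    then have "isomorphic B (map_graph f B)" using assms(2) by (rule isomorphic_map_graph)
    then show ?thesis
      using B by (metis isomorphic_simple iso_class_eq_iff subgraph_simple)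
  qed
  then have "image_mset iso_class (image_mset (map_graph f) (mset_set (blocks G)))
      = image_mset iso_class (mset_set (blocks G))"
    using finite_blocks[OF assms(1)] by (auto simp: multiset.map_comp intro: image_mset_cong)
  then show ?thesis
    by (simp add: graph_type_def blocks_map_graph[OF assms] image_mset_mset_set[OF inj])
qed

section \<open>Small non-separable graphs and unions\<close>

lemma nonseparable_connected:
  "\<not> separable H \<Longrightarrow> connected_graph H"
  unfolding separable_def connected_graph_def
  by (metis card.empty del_verts_empty empty_iff le0 psubsetI empty_subsetI)

text \<open>A walk from \<open>v\<close> to another vertex would start with an edge at
  \<open>v\<close>. This is what makes the single vertex exceptional among the non-separable
  graphs.\<close>

lemma nonseparable_isolated_vertex:
  assumes "simple_graph H" "\<not> separable H" "v \<in> verts H" "\<And>e. e \<in> edges H \<Longrightarrow> v \<notin> e"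
  shows "H = ({v}, {})"
proof -
  have "u = v" if u: "u \<in> verts H" for u
  proof (rule ccontr)
    assume "u \<noteq> v"
    have "(v, u) \<in> {(x, y). {x, y} \<in> edges H}\<^sup>*"
      using nonseparable_connected[OF assms(2)] assms(3) u by (auto simp: connected_graph_def)
    then obtain y where "{v, y} \<in> edges H"
      using \<open>u \<noteq> v\<close> by (auto elim: converse_rtranclE)
    then show False using assms(4) by blast
  qed
  then have V: "verts H = {v}" using assms(3) by blast
  have "edges H = {}"
  proof (rule ccontr)
    assume "edges H \<noteq> {}"
    then obtain e where "e \<in> edges H" by blast
    then have "e \<subseteq> {v}" "card e = 2" using simple_graph_edgeD[OF assms(1)] V by auto
    then show False using card_mono[of "{v}" e] by simp
  qed
  then show ?thesis using V by (simp add: prod_eq_iff)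
qed

lemma nonseparable_vertex: "\<not> separable ({v}, {})"
  by (auto simp: separable_def connected_graph_def del_verts_def)

lemma nonseparable_empty: "\<not> separable ({}, {})"
  by (auto simp: separable_def)

lemma nonseparable_edge:
  assumes "card e = 2"
  shows "\<not> separable (e, {e})"
proof -
  obtain x y where e: "e = {x, y}" "x \<noteq> y" using assms by (meson card_2_iff)
  have "(u, v) \<in> {(x, y). {x, y} \<in> edges (del_verts (e, {e}) K)}\<^sup>*"
    if "K \<subset> e" "u \<in> e - K" "v \<in> e - K" for K u v
  proof (cases "u = v")
    case False
    then have "e = {u, v}" "K = {}" using that e by auto
    then show ?thesis by auto
  qed simp
  then show ?thesis by (auto simp: separable_def connected_graph_def del_verts_def)
qed

text \<open>A set \<open>K\<close> deleted from a union need not lie inside \<open>H\<close>, so it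
  is cut down to \<open>verts H\<close>; the surviving vertex \<open>w\<close> keeps the
  intersection a proper subset, as \<open>separable\<close> demands.\<close>

lemma connected_del_verts:
  assumes "simple_graph H" "\<not> separable H" "finite K" "card K \<le> 1" "w \<in> verts H - K"
  shows "connected_graph (del_verts H K)"
proof -
  have "del_verts H K = del_verts H (K \<inter> verts H)"
    using simple_graph_edgeD(1)[OF assms(1)] by (auto simp: del_verts_def)
  moreover have "K \<inter> verts H \<subset> verts H" using assms(5) by blast
  moreover have "card (K \<inter> verts H) \<le> 1"
    using assms(3,4) by (meson card_mono inf_le1 le_trans)
  ultimately show ?thesis using assms(2) by (auto simp: separable_def)
qed

text \<open>Deleting at most one vertex spares one of the two common vertices, and through it the
  remains of both graphs, each still connected, are joined.\<close>

lemma nonseparable_Un: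
  assumes "simple_graph H1" "simple_graph H2" "\<not> separable H1" "\<not> separable H2"
    and "x \<noteq> y" "{x, y} \<subseteq> verts H1 \<inter> verts H2"
  shows "\<not> separable (verts H1 \<union> verts H2, edges H1 \<union> edges H2)"
proof
  let ?U = "(verts H1 \<union> verts H2, edges H1 \<union> edges H2)"
  assume "separable ?U"
  then obtain K where K: "K \<subset> verts ?U" "card K \<le> 1" "\<not> connected_graph (del_verts ?U K)"
    by (auto simp: separable_def)
  \<comment> \<open>Infinite sets have \<open>card\<close> 0, so the bound on \<open>card K\<close>
    says something only once \<open>K\<close> is known to be finite.\<close>
  have "finite K"
    using K(1) assms(1,2) by (auto simp: simple_graph_def intro: finite_subset)
  have "\<not> {x, y} \<subseteq> K"
    using card_mono[OF \<open>finite K\<close>, of "{x, y}"] K(2) assms(5) by auto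
  then obtain w where w: "w \<notin> K" "w \<in> verts H1" "w \<in> verts H2"
    using assms(6) by auto
  let ?R = "\<lambda>H. {(x, y). {x, y} \<in> edges (del_verts H K)}\<^sup>*"
  have conn: "(u, v) \<in> ?R ?U" if "H \<in> {H1, H2}" "u \<in> verts H - K" "v \<in> verts H - K" for H u v
  proof -
    have "connected_graph (del_verts H K)"
      using that w assms \<open>finite K\<close> K(2) by (intro connected_del_verts[where w = w]) auto
    then have "(u, v) \<in> ?R H"
      using that by (auto simp: connected_graph_def del_verts_def)
    moreover have "?R H \<subseteq> ?R ?U"
      using that(1) by (intro rtrancl_mono) (auto simp: del_verts_def)
    ultimately show ?thesis by blast
  qed
  have "(u, w) \<in> ?R ?U \<and> (w, u) \<in> ?R ?U" if "u \<in> verts ?U - K" for u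
    using that w conn[of H1] conn[of H2] by auto
  then have "(u, v) \<in> ?R ?U" if "u \<in> verts ?U - K" "v \<in> verts ?U - K" for u v
    using that by (meson rtrancl_trans)
  then show False
    using K(3) by (auto simp: connected_graph_def del_verts_def)
qed

section \<open>Existence and edge-disjointness of blocks\<close>

lemma block_containing:
  assumes "simple_graph X" "subgraph H X" "\<not> separable H"
  obtains B where "B \<in> blocks X" "subgraph H B"
proof -
  let ?P = "\<lambda>B. subgraph H B \<and> subgraph B X \<and> \<not> separable B"
  \<comment> \<open>A graph between \<open>H\<close> and \<open>X\<close> that maximizes this
    measure is a block, because a proper non-separable extension would increase it.\<close>
  let ?m = "\<lambda>B. card (verts B) + card (edges B)"
  have mono: "card (verts B) \<le> card (verts B')" "card (edges B) \<le> card (edges B')"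
    if "subgraph B B'" "simple_graph B'" for B B' :: "'a ugraph"
    using that by (auto simp: subgraph_def simple_graph_finite_edges simple_graph_finite_verts
        intro: card_mono)
  have "?P H" using assms by (simp add: subgraph_refl subgraph_simple)
  moreover have "\<forall>B. ?P B \<longrightarrow> ?m B < Suc (?m X)"
    using mono assms(1) by (meson add_mono le_imp_less_Suc)
  ultimately obtain B where B: "?P B" and max: "\<And>B'. ?P B' \<Longrightarrow> ?m B' \<le> ?m B"
    using ex_has_greatest_nat[of ?P H ?m "Suc (?m X)"] by blast
  have "B' = B" if B': "subgraph B' X" "\<not> separable B'" "subgraph B B'" for B'
  proof -
    have simple: "simple_graph B'" using B' subgraph_simple by blast
    have "?m B' \<le> ?m B" using B B' subgraph_trans max by blast
    then have "card (verts B) = card (verts B')" "card (edges B) = card (edges B')"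
      using mono[OF B'(3) simple] by linarith+
    then show ?thesis
      using B'(3) simple
      by (metis card_subset_eq prod_eqI simple_graph_finite_edges simple_graph_finite_verts
          subgraph_def)
  qed
  then have "B \<in> blocks X" using B by (auto simp: blocks_def)
  then show thesis using that B by blast
qed

lemma blockD:
  assumes "B \<in> blocks X"
  shows "subgraph B X" "\<not> separable B" "simple_graph B"
  using assms by (auto simp: blocks_def subgraph_def)

lemma block_maximal:
  assumes "B \<in> blocks X" "subgraph B B'" "subgraph B' X" "\<not> separable B'"
  shows "B' = B"
  using assms unfolding blocks_def by blast

text \<open>The graph without vertices is non-separable and contained in every graph, so it lies in
  some block. This is why a realizable type is never the empty multiset.\<close>

lemma blocks_nonempty: "simple_graph X \<Longrightarrow> blocks X \<noteq> {}"
  using block_containing[of X "({}, {})"] nonseparable_empty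
  by (metis empty_iff empty_subsetI fst_conv snd_conv finite.emptyI simple_graph_def subgraph_def)

text \<open>The ends of the edge are two common vertices, so the union is non-separable and, by
  maximality, equal to both blocks.\<close>

lemma blocks_eq_if_common_edge:
  assumes "simple_graph X" "B \<in> blocks X" "B' \<in> blocks X" "e \<in> edges B" "e \<in> edges B'"
  shows "B = B'"
proof -
  obtain x y where e: "e = {x, y}" "x \<noteq> y"
    using simple_graph_edgeD(2)[OF blockD(3)[OF assms(2)] assms(4)] by (meson card_2_iff)
  let ?U = "(verts B \<union> verts B', edges B \<union> edges B')"
  have "{x, y} \<subseteq> verts B \<inter> verts B'"
    using simple_graph_edgeD(1) assms blockD(3) e by (metis le_inf_iff)
  then have ns: "\<not> separable ?U"
    using blockD[OF assms(2)] blockD[OF assms(3)] e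
    by (intro nonseparable_Un[where x = x and y = y])
  have U: "subgraph ?U X" "subgraph B ?U" "subgraph B' ?U"
    using blockD[OF assms(2)] blockD[OF assms(3)] by (auto simp: subgraph_def simple_graph_def)
  have "?U = B" using assms(2) U(2,1) ns by (rule block_maximal)
  moreover have "?U = B'" using assms(3) U(3,1) ns by (rule block_maximal)
  ultimately show ?thesis by simp
qed

lemma edge_subgraph:
  assumes "simple_graph X" "e \<in> edges X"
  shows "subgraph (e, {e}) X"
  using assms simple_graph_edgeD[OF assms] by (auto simp: subgraph_def simple_graph_def card_ge_0_finite)

lemma vertex_subgraph: "v \<in> verts X \<Longrightarrow> subgraph ({v}, {}) X"
  by (auto simp: subgraph_def simple_graph_def)

lemma edge_in_block:
  assumes "simple_graph X" "e \<in> edges X"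
  obtains B where "B \<in> blocks X" "e \<in> edges B"
proof -
  obtain B where "B \<in> blocks X" "subgraph (e, {e}) B"
    using block_containing[OF assms(1) edge_subgraph[OF assms] nonseparable_edge]
      simple_graph_edgeD(2)[OF assms] by blast
  then show thesis using that[of B] by (simp add: subgraph_def)
qed

lemma vertex_in_block:
  assumes "simple_graph X" "v \<in> verts X"
  obtains B where "B \<in> blocks X" "v \<in> verts B"
proof -
  obtain B where "B \<in> blocks X" "subgraph ({v}, {}) B"
    using block_containing[OF assms(1) vertex_subgraph[OF assms(2)] nonseparable_vertex] by blast
  then show thesis using that[of B] by (simp add: subgraph_def)
qed

text \<open>A block with an isolated vertex is that vertex alone, and then an edge of
  \<open>X\<close> at it would be a larger non-separable subgraph.\<close>

lemma verts_block_eq_Union_edges: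
  assumes "simple_graph X" "\<Union> (edges X) = verts X" "B \<in> blocks X"
  shows "\<Union> (edges B) = verts B"
proof (intro equalityI subsetI)
  fix v assume v: "v \<in> verts B"
  show "v \<in> \<Union> (edges B)"
  proof (rule ccontr)
    assume "v \<notin> \<Union> (edges B)"
    then have B: "B = ({v}, {})"
      using v blockD[OF assms(3)] by (intro nonseparable_isolated_vertex) auto
    have "v \<in> verts X" using v blockD(1)[OF assms(3)] by (auto simp: subgraph_def)
    then obtain e where e: "e \<in> edges X" "v \<in> e" using assms(2) by blast
    have "subgraph B (e, {e})" using B e by (auto simp: subgraph_def simple_graph_def)
    then have "(e, {e}) = B"
      using assms(1,3) e(1) simple_graph_edgeD(2)[OF assms(1) e(1)]
      by (intro block_maximal) (auto simp: edge_subgraph nonseparable_edge)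
    then show False using B by simp
  qed
qed (use simple_graph_edgeD(1)[OF blockD(3)[OF assms(3)]] in blast)


section \<open>Covers by tuples of subgraphs\<close>

lemma verts_union_graph: "verts (union_graph Xs) = (\<Union>H\<in>set Xs. verts H)"
  and edges_union_graph: "edges (union_graph Xs) = (\<Union>H\<in>set Xs. edges H)"
  by (simp_all add: union_graph_def)

lemma union_graph_map_graph: "union_graph (map (map_graph f) Xs) = map_graph f (union_graph Xs)"
  by (auto simp: union_graph_def map_graph_def)

lemma subgraph_union_graph:
  assumes "\<And>H. H \<in> set Xs \<Longrightarrow> subgraph H X"
  shows "subgraph (union_graph Xs) X"
proof -
  have H: "finite (verts H)" "verts H \<subseteq> verts X" "edges H \<subseteq> edges X"
    "\<And>e. e \<in> edges H \<Longrightarrow> e \<subseteq> verts H \<and> card e = 2" if "H \<in> set Xs" for H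
    using assms[OF that] by (auto simp: subgraph_def simple_graph_def)
  have "finite (verts (union_graph Xs))" using H(1) by (simp add: verts_union_graph)
  moreover have "verts (union_graph Xs) \<subseteq> verts X" "edges (union_graph Xs) \<subseteq> edges X"
    unfolding verts_union_graph edges_union_graph using H(2,3) by (simp_all add: UN_subset_iff)
  moreover have "e \<subseteq> verts (union_graph Xs) \<and> card e = 2" if e: "e \<in> edges (union_graph Xs)" for e
  proof -
    obtain H where "H \<in> set Xs" "e \<in> edges H"
      using e unfolding edges_union_graph by blast
    then show ?thesis using H(4) unfolding verts_union_graph by blast
  qed
  ultimately show ?thesis by (simp add: subgraph_def simple_graph_def)
qed

lemma cover_tuplesD:
  assumes "Xs \<in> cover_tuples Fs X"
  shows "length Xs = length Fs" "\<And>H. H \<in> set Xs \<Longrightarrow> subgraph H X" "union_graph Xs = X"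
  using assms by (auto simp: cover_tuples_def list_all2_conv_all_nth in_set_conv_nth)

lemma cover_tuples_isomorphic:
  assumes "Xs \<in> cover_tuples Fs X" "H \<in> set Xs"
  obtains F where "F \<in> set Fs" "isomorphic H F"
proof -
  obtain i where "i < length Xs" "H = Xs ! i" using assms(2) by (auto simp: in_set_conv_nth)
  then show thesis
    using assms(1) that[of "Fs ! i"] by (auto simp: cover_tuples_def list_all2_conv_all_nth)
qed

lemma finite_cover_tuples:
  assumes "simple_graph X"
  shows "finite (cover_tuples Fs X)"
proof (rule finite_subset)
  show "cover_tuples Fs X \<subseteq> {Xs. set Xs \<subseteq> {H. subgraph H X} \<and> length Xs = length Fs}"
    using cover_tuplesD by blast
qed (simp add: finite_lists_length_eq finite_subgraphs assms)

text \<open>Applying \<open>map_graph f\<close> to every entry is a bijection between the two sets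
  of tuples, because it respects unions and the isomorphism class of each entry.\<close>

lemma card_cover_tuples_map_graph:
  assumes "simple_graph X" "inj_on f (verts X)"
  shows "card (cover_tuples Fs (map_graph f X)) = card (cover_tuples Fs X)"
proof -
  let ?S = "{H. subgraph H X}"
  have inj: "inj_on (map_graph f) ?S" using assms(2) by (rule inj_on_map_graph)
  have iff: "map (map_graph f) Xs \<in> cover_tuples Fs (map_graph f X) \<longleftrightarrow> Xs \<in> cover_tuples Fs X"
    if Xs: "set Xs \<subseteq> ?S" for Xs
  proof -
    have "subgraph (union_graph Xs) X" using Xs by (intro subgraph_union_graph) blast
    then have "map_graph f (union_graph Xs) = map_graph f X \<longleftrightarrow> union_graph Xs = X"
      using inj assms(1) by (auto simp: subgraph_refl dest: inj_onD)
    moreover have "list_all2 (\<lambda>H F. subgraph (map_graph f H) (map_graph f X) \<and>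
          isomorphic (map_graph f H) F) Xs Fs
        \<longleftrightarrow> list_all2 (\<lambda>H F. subgraph H X \<and> isomorphic H F) Xs Fs"
      using Xs assms(2) subgraph_map_graph isomorphic_map_graph_iff
      by (intro list.rel_cong refl) blast
    ultimately show ?thesis
      by (simp add: cover_tuples_def list_all2_map1 union_graph_map_graph)
  qed
  have "cover_tuples Fs (map_graph f X) = map (map_graph f) ` cover_tuples Fs X"
  proof (intro equalityI subsetI)
    fix Ys assume Ys: "Ys \<in> cover_tuples Fs (map_graph f X)"
    then have "set Ys \<subseteq> map_graph f ` ?S"
      using cover_tuplesD(2)[OF Ys] subgraphs_map_graph[OF assms] by blast
    then have "Ys \<in> map (map_graph f) ` lists ?S"
      by (metis in_listsI lists_image subsetD)
    then obtain Xs where "Ys = map (map_graph f) Xs" "set Xs \<subseteq> ?S" by (auto simp: lists_eq_set)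
    then show "Ys \<in> map (map_graph f) ` cover_tuples Fs X" using Ys iff by blast
  next
    fix Ys assume "Ys \<in> map (map_graph f) ` cover_tuples Fs X"
    then obtain Xs where "Ys = map (map_graph f) Xs" and Xs: "Xs \<in> cover_tuples Fs X" by blast
    moreover have "set Xs \<subseteq> ?S" using cover_tuplesD(2)[OF Xs] by blast
    ultimately show "Ys \<in> cover_tuples Fs (map_graph f X)" using iff by blast
  qed
  moreover have "inj_on (map (map_graph f)) (cover_tuples Fs X)"
  proof (rule inj_on_subset)
    show "inj_on (map (map_graph f)) (lists ?S)"
      using inj by (rule inj_on_map_lists)
    show "cover_tuples Fs X \<subseteq> lists ?S" using cover_tuplesD(2)[of _ Fs X] by (fastforce simp: lists_eq_set)
  qed
  ultimately show ?thesis by (simp add: card_image)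
qed

section \<open>Counting tuples of copies\<close>

lemma finite_list_all2:
  assumes "\<And>y. y \<in> set ys \<Longrightarrow> finite {x. P x y}"
  shows "finite {xs. list_all2 P xs ys}"
    and "card {xs. list_all2 P xs ys} = (\<Prod>y\<leftarrow>ys. card {x. P x y})"
  using assms
proof (induction ys)
  case (Cons y ys)
  let ?A = "{x. P x y} \<times> {xs. list_all2 P xs ys}"
  have eq: "{xs. list_all2 P xs (y # ys)} = (\<lambda>(x, xs). x # xs) ` ?A"
    by (auto simp: list_all2_Cons2)
  have inj: "inj_on (\<lambda>(x, xs). x # xs) ?A" by (auto simp: inj_on_def)
  {
    case 1
    then show ?case using Cons.IH(1) eq by simp
  next
    case 2
    then show ?case using Cons.IH(2) inj by (simp add: eq card_image card_cartesian_product)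
  }
qed simp_all

text \<open>A tuple of copies of the members of \<open>S\<close> in \<open>G\<close> covers exactly one subgraph of \<open>G\<close>,
  namely its union.\<close>

lemma p_eq_sum_c_graph:
  assumes "simple_graph G"
  shows "p G S = (\<Sum>X | subgraph X G. c_graph S X)"
proof -
  let ?Fs = "repr_family S"
  let ?P = "\<lambda>H F. subgraph H G \<and> isomorphic H F"
  have fin: "finite {H. ?P H F}" for F :: "nat ugraph"
    by (rule finite_subset[OF _ finite_subgraphs[OF assms]]) auto
  have un: "{Xs. list_all2 ?P Xs ?Fs} = (\<Union>X\<in>{X. subgraph X G}. cover_tuples ?Fs X)"
  proof (intro equalityI subsetI)
    fix Xs assume Xs: "Xs \<in> {Xs. list_all2 ?P Xs ?Fs}"
    then have sub: "subgraph H G" if "H \<in> set Xs" for H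
      using that by (auto simp: list_all2_conv_all_nth in_set_conv_nth)
    then have "subgraph H (union_graph Xs)" if "H \<in> set Xs" for H
      using that by (fastforce simp: union_graph_def subgraph_def)
    then have "Xs \<in> cover_tuples ?Fs (union_graph Xs)"
      using Xs by (auto simp: cover_tuples_def list_all2_conv_all_nth)
    then show "Xs \<in> (\<Union>X\<in>{X. subgraph X G}. cover_tuples ?Fs X)"
      using subgraph_union_graph[OF sub] by blast
  next
    fix Xs assume "Xs \<in> (\<Union>X\<in>{X. subgraph X G}. cover_tuples ?Fs X)"
    then show "Xs \<in> {Xs. list_all2 ?P Xs ?Fs}"
      by (auto simp: cover_tuples_def elim!: list_all2_mono intro: subgraph_trans)
  qed
  have "p G S = card {Xs. list_all2 ?P Xs ?Fs}"
    unfolding p_def num_copies_def using fin by (simp add: finite_list_all2(2))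
  also have "\<dots> = (\<Sum>X | subgraph X G. card (cover_tuples ?Fs X))"
    unfolding un
  proof (rule card_UN_disjoint)
    show "\<forall>X\<in>{X. subgraph X G}. \<forall>Y\<in>{X. subgraph X G}.
        X \<noteq> Y \<longrightarrow> cover_tuples ?Fs X \<inter> cover_tuples ?Fs Y = {}"
      using cover_tuplesD(3) by blast
  qed (auto simp: finite_subgraphs assms intro: finite_cover_tuples subgraph_simple)
  finally show ?thesis by (simp add: c_graph_def)
qed


section \<open>Types of graphs\<close>

text \<open>Excludes multisets such as the empty one, or one mixing the graph without vertices with
  other blocks. Only for a realizable type does the choice in \<open>c\<close> pick a graph of that
  type.\<close>

definition realizable :: "gtype \<Rightarrow> bool" where
  "realizable S \<longleftrightarrow> (\<exists>X :: nat ugraph. simple_graph X \<and> graph_type X = S)"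

text \<open>Links subgraphs of \<open>G\<close>, over any vertex type, with the graphs on natural
  numbers over which the definitions of \<open>c\<close> and \<preceq> range. The explicit vertex
  set serves \<open>finite_type_le\<close>.\<close>

lemma nat_representative:
  assumes "simple_graph X"
  obtains Y :: "nat ugraph" where "simple_graph Y" "graph_type Y = graph_type X"
    "\<And>S. c_graph S Y = c_graph S X" "verts Y = {..<card (verts X)}"
proof -
  obtain f :: "'a \<Rightarrow> nat" where f: "inj_on f (verts X)" "f ` verts X = {..<card (verts X)}"
    using ex_nat_copy[OF assms] by blast
  show thesis
    by (rule that[of "map_graph f X"])
       (simp_all add: f assms simple_map_graph graph_type_map_graph c_graph_def
         card_cover_tuples_map_graph)
qed

lemma realizable_graph_type: "simple_graph X \<Longrightarrow> realizable (graph_type X)"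
  by (metis nat_representative realizable_def)

lemma c_graph_eq_c:
  assumes "c_type_invariant S" "simple_graph X"
  shows "c_graph S X = c S (graph_type X)"
proof -
  obtain Y :: "nat ugraph" where Y: "simple_graph Y" "graph_type Y = graph_type X"
    "c_graph S Y = c_graph S X"
    using nat_representative[OF assms(2)] by metis
  define Z :: "nat ugraph" where "Z = (SOME Z. simple_graph Z \<and> graph_type Z = graph_type X)"
  have "simple_graph Z \<and> graph_type Z = graph_type X"
    unfolding Z_def by (rule someI[of _ Y]) (use Y in simp)
  then have "c_graph S Z = c_graph S Y"
    using assms(1) Y unfolding c_type_invariant_def by metis
  then show ?thesis using Y unfolding c_def Z_def by metis
qed

lemma c_eq_0: "\<not> realizable S' \<Longrightarrow> c S S' = 0"
  by (auto simp: c_def realizable_def)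

lemma type_leI:
  assumes "simple_graph X" "c_graph S X \<noteq> 0"
  shows "graph_type X \<preceq> S"
proof -
  obtain Y :: "nat ugraph" where "simple_graph Y" "graph_type Y = graph_type X"
    "c_graph S Y = c_graph S X"
    using nat_representative[OF assms(1)] by metis
  then show ?thesis using assms(2) unfolding type_le_def by (intro exI[of _ Y]) simp
qed

lemma type_leE:
  assumes "S' \<preceq> S"
  obtains X :: "nat ugraph" and Xs where "simple_graph X" "graph_type X = S'"
    "Xs \<in> cover_tuples (repr_family S) X"
proof -
  obtain X :: "nat ugraph" where X: "simple_graph X" "graph_type X = S'" "c_graph S X \<noteq> 0"
    using assms unfolding type_le_def by blast
  then have "cover_tuples (repr_family S) X \<noteq> {}" by (metis c_graph_def card.empty)
  then show thesis using that X(1,2) by blast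
qed

lemma type_le_realizable: "S' \<preceq> S \<Longrightarrow> realizable S'"
  by (auto simp: type_le_def realizable_def)

text \<open>The blocks of a graph of type \<open>S\<close> witness the choice. Non-separability is
  not built into \<open>repr_family\<close>; each member inherits it from a block in the same
  isomorphism class.\<close>

lemma repr_family:
  assumes "realizable S"
  shows "family_type (repr_family S) = S"
    and "\<And>F. F \<in> set (repr_family S) \<Longrightarrow> simple_graph F"
    and "\<And>F. F \<in> set (repr_family S) \<Longrightarrow> \<not> separable F"
proof -
  obtain X :: "nat ugraph" where X: "simple_graph X" "graph_type X = S"
    using assms by (auto simp: realizable_def)
  obtain Bs where Bs: "set Bs = blocks X" "distinct Bs"
    using finite_distinct_list[OF finite_blocks[OF X(1)]] by blast
  have "family_type Bs = S"
    using Bs X(2) by (simp add: family_type_def graph_type_def mset_set_set flip: Bs(1))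
  moreover have "\<forall>F\<in>set Bs. simple_graph F" using Bs(1) blockD(3) by blast
  ultimately have "(\<forall>F\<in>set Bs. simple_graph F) \<and> family_type Bs = S" by blast
  then have *: "(\<forall>F\<in>set (repr_family S). simple_graph F) \<and> family_type (repr_family S) = S"
    unfolding repr_family_def by (rule someI)
  then show "family_type (repr_family S) = S"
    and simple: "\<And>F. F \<in> set (repr_family S) \<Longrightarrow> simple_graph F" by auto
  fix F assume F: "F \<in> set (repr_family S)"
  then have "iso_class F \<in># family_type (repr_family S)" by (simp add: family_type_def)
  then obtain B where B: "B \<in> blocks X" "iso_class B = iso_class F"
    using X finite_blocks[OF X(1)] * by (auto simp: graph_type_def)
  then have "isomorphic B F"
    using iso_class_eq_iff blockD(3) simple[OF F] by blast
  then show "\<not> separable F" using B(1) blockD isomorphic_nonseparable by blast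
qed

lemma realizable_not_empty: "realizable S \<Longrightarrow> S \<noteq> {#}"
proof
  assume "realizable S" "S = {#}"
  then obtain X :: "nat ugraph" where X: "simple_graph X" "graph_type X = {#}"
    unfolding realizable_def by blast
  then show False
    using blocks_nonempty[OF X(1)] finite_blocks[OF X(1)]
    by (simp add: graph_type_def mset_set_empty_iff)
qed

section \<open>Covering tuples and the diagonal values of \<open>c\<close>\<close>

lemma cover_tuple_nonseparable:
  assumes "realizable S" "Xs \<in> cover_tuples (repr_family S) X" "H \<in> set Xs"
  shows "\<not> separable H"
proof -
  obtain F where F: "F \<in> set (repr_family S)" "isomorphic H F"
    using assms(2,3) by (rule cover_tuples_isomorphic)
  have "simple_graph H" using cover_tuplesD(2)[OF assms(2,3)] subgraph_simple by blast
  then show ?thesis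
    using F repr_family(2,3)[OF assms(1) F(1)] isomorphic_nonseparable isomorphic_sym by blast
qed

lemma family_type_cover_tuple:
  assumes "realizable S" "Xs \<in> cover_tuples (repr_family S) X"
  shows "family_type Xs = S"
proof -
  have "map iso_class Xs = map iso_class (repr_family S)"
  proof (rule nth_equalityI)
    fix i assume "i < length (map iso_class Xs)"
    then have i: "i < length Xs" by simp
    then have "subgraph (Xs ! i) X" "isomorphic (Xs ! i) (repr_family S ! i)"
      using assms(2) by (auto simp: cover_tuples_def list_all2_conv_all_nth)
    then have "iso_class (Xs ! i) = iso_class (repr_family S ! i)"
      by (metis isomorphic_simple iso_class_eq_iff subgraph_simple)
    then show "map iso_class Xs ! i = map iso_class (repr_family S) ! i"
      using i cover_tuplesD(1)[OF assms(2)] by simp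
  qed (simp add: cover_tuplesD(1)[OF assms(2)])
  then show ?thesis using repr_family(1)[OF assms(1)] by (simp add: family_type_def)
qed

lemma union_graph_blocks:
  assumes "simple_graph X" "set Bs = blocks X"
  shows "union_graph Bs = X"
proof -
  have "verts B \<subseteq> verts X" "edges B \<subseteq> edges X" if "B \<in> blocks X" for B
    using blockD(1)[OF that] by (simp_all add: subgraph_def)
  moreover have "v \<in> (\<Union>B\<in>blocks X. verts B)" if "v \<in> verts X" for v
    using vertex_in_block[OF assms(1) that] by blast
  moreover have "e \<in> (\<Union>B\<in>blocks X. edges B)" if "e \<in> edges X" for e
    using edge_in_block[OF assms(1) that] by blast
  ultimately show ?thesis
    unfolding prod_eq_iff verts_union_graph edges_union_graph assms(2)
    by (intro conjI equalityI UN_least) (assumption | rule subsetI)+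
qed

text \<open>Lifts an ordering of the images to one of the elements; used to list the blocks of a
  graph in the order of a representing family.\<close>

lemma image_mset_eq_mset:
  assumes "image_mset f M = mset xs"
  obtains zs where "mset zs = M" "map f zs = xs"
proof -
  have "\<exists>zs. mset zs = M \<and> map f zs = xs"
    using assms
  proof (induction xs arbitrary: M)
    case (Cons x xs)
    then obtain M' a where M': "M = add_mset a M'" "f a = x" "image_mset f M' = mset xs"
      using msed_map_invR[of f M x "mset xs"] by auto
    then obtain zs where "mset zs = M'" "map f zs = xs" using Cons.IH by blast
    then show ?case using M' by (intro exI[of _ "a # zs"]) simp
  qed simp
  then show thesis using that by blast
qed

text \<open>The blocks of \<open>X\<close>, listed in the order of
  \<open>repr_family (graph_type X)\<close>, form a covering tuple.\<close>

lemma c_graph_self: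
  assumes "simple_graph X"
  shows "c_graph (graph_type X) X \<noteq> 0"
proof -
  let ?Fs = "repr_family (graph_type X)"
  obtain Bs where Bs: "set Bs = blocks X" "distinct Bs"
    using finite_distinct_list[OF finite_blocks[OF assms]] by blast
  have real: "realizable (graph_type X)" using assms by (rule realizable_graph_type)
  have "image_mset iso_class (mset Bs) = graph_type X"
    unfolding graph_type_def Bs(1)[symmetric] mset_set_set[OF Bs(2)] ..
  also have "\<dots> = mset (map iso_class ?Fs)"
    using repr_family(1)[OF real] by (simp only: family_type_def)
  finally obtain Xs where Xs: "mset Xs = mset Bs" "map iso_class Xs = map iso_class ?Fs"
    by (rule image_mset_eq_mset)
  have set: "set Xs = blocks X" using Xs(1) Bs(1) by (metis set_mset_mset)
  have "length Xs = length ?Fs" using Xs(2) by (rule map_eq_imp_length_eq)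
  moreover have "isomorphic (Xs ! i) (?Fs ! i)" if "i < length ?Fs" for i
  proof -
    have "iso_class (Xs ! i) = iso_class (?Fs ! i)"
      using Xs(2) that calculation by (metis nth_map)
    then show ?thesis
      using iso_class_eq_iff set blockD(3) repr_family(2)[OF real] that calculation
      by (metis nth_mem)
  qed
  moreover have "subgraph (Xs ! i) X" if "i < length ?Fs" for i
    using set blockD(1) that calculation(1) by (metis nth_mem)
  ultimately have "Xs \<in> cover_tuples ?Fs X"
    using union_graph_blocks[OF assms set] by (auto simp: cover_tuples_def list_all2_conv_all_nth)
  then show ?thesis
    using finite_cover_tuples[OF assms] unfolding c_graph_def card_eq_0_iff by blast
qed

text \<open>These are the pivots by which the triangular system is divided.\<close>

lemma c_self:
  assumes "realizable S"
  shows "c S S \<noteq> 0"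
proof -
  define X :: "nat ugraph" where "X = (SOME X. simple_graph X \<and> graph_type X = S)"
  have "simple_graph X \<and> graph_type X = S"
    unfolding X_def by (rule someI_ex) (use assms in \<open>simp add: realizable_def\<close>)
  then have "c_graph S X \<noteq> 0" using c_graph_self by blast
  then show ?thesis using assms by (simp add: c_def realizable_def X_def)
qed

text \<open>Every block \<open>B\<close> of \<open>X\<close> contains a member of the covering tuple, and no member is contained in
  two blocks chosen in this way, because it contains an edge (or the vertex) of its block.\<close>

lemma cover_tuple_blocks:
  assumes "simple_graph X" "union_graph Xs = X" "Xs \<noteq> []"
    and "\<And>H. H \<in> set Xs \<Longrightarrow> subgraph H X \<and> \<not> separable H"
  obtains g where "inj_on g (blocks X)" "g ` blocks X \<subseteq> set Xs"
    "\<And>B. B \<in> blocks X \<Longrightarrow> subgraph (g B) B"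
    "\<And>B. B \<in> blocks X \<Longrightarrow> edges B = {} \<Longrightarrow> g B = B"
proof -
  have V: "verts X = (\<Union>H\<in>set Xs. verts H)" and E: "edges X = (\<Union>H\<in>set Xs. edges H)"
    using assms(2) verts_union_graph[of Xs] edges_union_graph[of Xs] by simp_all
  \<comment> \<open>\<open>A\<close> ties the member \<open>H\<close> to \<open>B\<close>: it lies
    in \<open>H\<close> and in no block other than \<open>B\<close>. It is an edge of
    \<open>B\<close>, or \<open>B\<close> itself if \<open>B\<close> has no edges.\<close>
  have "\<exists>H\<in>set Xs. \<exists>A. subgraph A H \<and> (\<forall>B'\<in>blocks X. subgraph A B' \<longrightarrow> B' = B) \<and>
      (edges B = {} \<longrightarrow> A = B)" if B: "B \<in> blocks X" for B
  proof (cases "edges B = {}")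
    case False
    then obtain e where e: "e \<in> edges B" by blast
    then have "e \<in> edges X" using blockD(1)[OF B] by (auto simp: subgraph_def)
    then obtain H where H: "H \<in> set Xs" "e \<in> edges H"
      unfolding E by blast
    have "subgraph (e, {e}) H"
      using H assms(4) by (intro edge_subgraph) (auto simp: subgraph_def)
    moreover have "B' = B" if "B' \<in> blocks X" "subgraph (e, {e}) B'" for B'
      using blocks_eq_if_common_edge[OF assms(1) that(1) B _ e] that(2)
      by (simp add: subgraph_def)
    ultimately show ?thesis using H(1) False by blast
  next
    case True
    have "\<exists>H\<in>set Xs. verts B \<subseteq> verts H"
    proof (cases "verts B = {}")
      case False
      then obtain v where v: "v \<in> verts B" by blast
      then have "verts B = {v}"
        using nonseparable_isolated_vertex[of B v] blockD[OF B] True by auto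
      moreover have "v \<in> verts X" using v blockD(1)[OF B] by (auto simp: subgraph_def)
      then obtain H where "H \<in> set Xs" "v \<in> verts H" unfolding V by blast
      ultimately show ?thesis by (intro bexI[of _ H]) simp
    next
      \<comment> \<open>Here \<open>B\<close> is the graph without vertices, contained in every
        member; \<open>Xs\<close> being nonempty supplies one.\<close>
      case True
      then show ?thesis using assms(3) hd_in_set by blast
    qed
    then obtain H where "H \<in> set Xs" "subgraph B H"
      using True blockD(3)[OF B] by (auto simp: subgraph_def)
    moreover have "B' = B" if "B' \<in> blocks X" "subgraph B B'" for B'
      using block_maximal[OF B that(2)] blockD[OF that(1)] by blast
    ultimately show ?thesis by blast
  qed
  then obtain g A where gA: "\<And>B. B \<in> blocks X \<Longrightarrow> g B \<in> set Xs \<and> subgraph (A B) (g B) \<and>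
      (\<forall>B'\<in>blocks X. subgraph (A B) B' \<longrightarrow> B' = B) \<and> (edges B = {} \<longrightarrow> A B = B)"
    by metis
  \<comment> \<open>The non-separable \<open>g B\<close> lies in some block, and that block contains
    \<open>A B\<close>, so it is \<open>B\<close>.\<close>
  have sub: "subgraph (g B) B" if B: "B \<in> blocks X" for B
  proof -
    obtain B' where "B' \<in> blocks X" "subgraph (g B) B'"
      using gA[OF B] assms(1,4) block_containing by metis
    then show ?thesis using gA[OF B] subgraph_trans by metis
  qed
  show thesis
  proof (rule that[of g])
    show "inj_on g (blocks X)"
      by (rule inj_onI) (metis gA sub subgraph_trans)
    show "g ` blocks X \<subseteq> set Xs" using gA by blast
    show "subgraph (g B) B" if "B \<in> blocks X" for B using sub that .
    show "g B = B" if "B \<in> blocks X" "edges B = {}" for B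
      using gA[OF that(1)] sub[OF that(1)] that(2) subgraph_antisym by metis
  qed
qed

section \<open>Well-foundedness and finiteness of the order\<close>

lemma type_less_size:
  assumes "realizable S" "S' \<prec> S"
  shows "size S' < size S"
proof -
  obtain X :: "nat ugraph" and Xs where X: "simple_graph X" "graph_type X = S'"
    and Xs: "Xs \<in> cover_tuples (repr_family S) X"
    using assms(2) type_leE unfolding type_less_def by metis
  have type: "family_type Xs = S" using assms(1) Xs by (rule family_type_cover_tuple)
  have E: "edges X = (\<Union>H\<in>set Xs. edges H)"
    using cover_tuplesD(3)[OF Xs] edges_union_graph[of Xs] by simp
  have sizes: "size S' = card (blocks X)" "size S = length Xs"
    using X(2) type by (auto simp: graph_type_def family_type_def)
  have Xs_ne: "Xs \<noteq> []" using type realizable_not_empty[OF assms(1)] by (auto simp: family_type_def)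
  have memb: "subgraph H X \<and> \<not> separable H" if "H \<in> set Xs" for H
    using that cover_tuplesD(2)[OF Xs] cover_tuple_nonseparable[OF assms(1) Xs] by blast
  obtain g where g: "inj_on g (blocks X)" "g ` blocks X \<subseteq> set Xs"
    "\<And>B. B \<in> blocks X \<Longrightarrow> subgraph (g B) B"
    "\<And>B. B \<in> blocks X \<Longrightarrow> edges B = {} \<Longrightarrow> g B = B"
    using cover_tuple_blocks[OF X(1) cover_tuplesD(3)[OF Xs] Xs_ne memb] by blast
  have card_le: "card (blocks X) \<le> card (set Xs)"
    using g(1,2) by (metis card_image card_mono List.finite_set)
  moreover have "card (set Xs) \<le> length Xs" by (rule card_length)
  moreover have "card (blocks X) \<noteq> length Xs"
  proof
    assume eq: "card (blocks X) = length Xs"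
    \<comment> \<open>Types count repetitions but \<open>set Xs\<close> does not; equality of the
      numbers squeezes \<open>card (set Xs)\<close> and rules repetitions out.\<close>
    then have dist: "distinct Xs" using card_le card_length[of Xs] by (simp add: card_distinct)
    have surj: "g ` blocks X = set Xs"
      using g(1,2) eq dist by (metis card_image card_subset_eq distinct_card List.finite_set)
    have "g B = B" if B: "B \<in> blocks X" for B
    proof (cases "edges B = {}")
      case False
      \<comment> \<open>An edge of \<open>B\<close> is covered by some \<open>g B'\<close>, which
        lies inside \<open>B'\<close>; since distinct blocks share no edge,
        \<open>B' = B\<close>.\<close>
      have "edges B \<subseteq> edges (g B)"
      proof
        fix e assume e: "e \<in> edges B"
        then have "e \<in> edges X" using blockD(1)[OF B] by (auto simp: subgraph_def)
        then obtain B' where B': "B' \<in> blocks X" "e \<in> edges (g B')"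
          unfolding E surj[symmetric] by blast
        then have "e \<in> edges B'" using g(3)[OF B'(1)] by (auto simp: subgraph_def)
        then have "B' = B" using blocks_eq_if_common_edge[OF X(1) B'(1) B] e by blast
        then show "e \<in> edges (g B)" using B'(2) by simp
      qed
      moreover have "verts B \<subseteq> verts (g B)"
      proof
        fix v assume "v \<in> verts B"
        then obtain e where "e \<in> edges B" "v \<in> e"
          using nonseparable_isolated_vertex[OF blockD(3,2)[OF B]] False by fastforce
        then show "v \<in> verts (g B)"
          using calculation g(3)[OF B] by (meson subgraph_simple simple_graph_edgeD(1) subsetD)
      qed
      ultimately show ?thesis
        using g(3)[OF B] by (auto simp: subgraph_def prod_eq_iff)
    qed (use g(4) B in blast)
    then have "set Xs = blocks X" using surj by force
    then have "graph_type X = family_type Xs"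
      using dist by (simp add: graph_type_def family_type_def mset_set_set flip: \<open>set Xs = _\<close>)
    then show False using X(2) type assms(2) by (simp add: type_less_def)
  qed
  ultimately show ?thesis using sizes by linarith
qed

text \<open>A covered graph has at most as many vertices as the members together, so a copy of it
  lives on \<open>{..<?N}\<close>. Finiteness matters because \<open>sum\<close> over an infinite
  set is 0.\<close>

lemma finite_type_le:
  assumes "realizable S"
  shows "finite {S'. S' \<preceq> S}"
proof (rule finite_subset)
  let ?N = "\<Sum>F\<leftarrow>repr_family S. card (verts F)"
  show "{S'. S' \<preceq> S} \<subseteq> graph_type ` (Pow {..<?N} \<times> Pow (Pow {..<?N}))"
  proof safe
    fix S' assume "S' \<preceq> S"
    then obtain X :: "nat ugraph" and Xs where X: "simple_graph X" "graph_type X = S'"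
      and Xs: "Xs \<in> cover_tuples (repr_family S) X"
      by (rule type_leE)
    obtain Y :: "nat ugraph" where Y: "simple_graph Y" "graph_type Y = S'"
      "verts Y = {..<card (verts X)}"
      using nat_representative[OF X(1)] X(2) by metis
    have "map (card \<circ> verts) Xs = map (card \<circ> verts) (repr_family S)"
      using Xs by (intro nth_equalityI)
        (auto simp: cover_tuples_def list_all2_conv_all_nth isomorphic_card_verts)
    then have sum: "(\<Sum>H\<leftarrow>Xs. card (verts H)) = ?N" by (simp add: comp_def)
    have "verts X = (\<Union>H\<in>set Xs. verts H)"
      using cover_tuplesD(3)[OF Xs] verts_union_graph[of Xs] by simp
    moreover have "card (\<Union>H\<in>set Ys. verts H) \<le> (\<Sum>H\<leftarrow>Ys. card (verts H))"
      for Ys :: "nat ugraph list"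
      by (induction Ys) (auto intro: card_Un_le[THEN order_trans])
    ultimately have "card (verts X) \<le> ?N" using sum by metis
    then have "verts Y \<subseteq> {..<?N}" using Y(3) by auto
    moreover have "edges Y \<subseteq> Pow (verts Y)" using simple_graph_edgeD(1)[OF Y(1)] by blast
    ultimately have "Y \<in> Pow {..<?N} \<times> Pow (Pow {..<?N})" by (auto simp: mem_Times_iff)
    then show "S' \<in> graph_type ` (Pow {..<?N} \<times> Pow (Pow {..<?N}))" using Y(2) by blast
  qed
qed simp


section \<open>Inversion along chains\<close>

lemma p_eq_sum_types:
  assumes "simple_graph G" "realizable S" "c_type_invariant S"
  shows "p G S = (\<Sum>S' | S' \<preceq> S. c S S' * num_of_type G S')"
proof -
  let ?T = "{S'. S' \<preceq> S}" and ?X = "{X. subgraph X G \<and> graph_type X \<preceq> S}"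
  have fin: "finite ?X" by (rule finite_subset[OF _ finite_subgraphs[OF assms(1)]]) auto
  \<comment> \<open>A subgraph whose type is not below \<open>S\<close> is covered by no tuple and
    drops out.\<close>
  have "p G S = (\<Sum>X\<in>?X. c_graph S X)"
    unfolding p_eq_sum_c_graph[OF assms(1)]
    using finite_subgraphs[OF assms(1)] type_leI subgraph_simple
    by (intro sum.mono_neutral_right) blast+
  also have "\<dots> = (\<Sum>X\<in>?X. c S (graph_type X))"
    using c_graph_eq_c[OF assms(3)] subgraph_simple by (intro sum.cong) blast+
  also have "\<dots> = (\<Sum>S'\<in>?T. \<Sum>X | X \<in> ?X \<and> graph_type X = S'. c S (graph_type X))"
    using fin finite_type_le[OF assms(2)] by (intro sum.group[symmetric]) auto
  also have "\<dots> = (\<Sum>S'\<in>?T. c S S' * num_of_type G S')"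
  proof (rule sum.cong)
    fix S' assume "S' \<in> ?T"
    then have "{X \<in> ?X. graph_type X = S'} = {X. subgraph X G \<and> graph_type X = S'}" by auto
    then show "(\<Sum>X | X \<in> ?X \<and> graph_type X = S'. c S (graph_type X)) = c S S' * num_of_type G S'"
      by (simp add: num_of_type_def)
  qed simp
  finally show ?thesis .
qed

section \<open>Recursion over chains\<close>

lemma type_chains_eq:
  "type_chains S = insert [S] (\<Union>S'\<in>{S'. S' \<prec> S}. (#) S ` type_chains S')"
proof (intro equalityI subsetI)
  fix Ss assume Ss: "Ss \<in> type_chains S"
  then obtain Ts where Ts: "Ss = S # Ts" by (cases Ss) (auto simp: type_chains_def)
  show "Ss \<in> insert [S] (\<Union>S'\<in>{S'. S' \<prec> S}. (#) S ` type_chains S')"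
  proof (cases Ts)
    case (Cons S' Us)
    have chain: "Ss ! Suc i \<prec> Ss ! i" if "Suc i < length Ss" for i
      using Ss that by (auto simp: type_chains_def)
    have "S' \<prec> S" using chain[of 0] Ts Cons by simp
    moreover have "Ts \<in> type_chains S'"
      using chain[of "Suc _"] Ts Cons by (auto simp: type_chains_def)
    ultimately show ?thesis using Ts by blast
  qed (simp add: Ts)
next
  fix Ss assume "Ss \<in> insert [S] (\<Union>S'\<in>{S'. S' \<prec> S}. (#) S ` type_chains S')"
  then consider "Ss = [S]" | S' Ts where "S' \<prec> S" "Ts \<in> type_chains S'" "Ss = S # Ts" by blast
  then show "Ss \<in> type_chains S"
  proof cases
    case (2 S' Ts)
    then show ?thesis by (auto simp: type_chains_def nth_Cons split: nat.split)
  qed (simp add: type_chains_def)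
qed

lemma chain_term_singleton: "chain_term G [S] = real (p G S) / real (c S S)"
  by (simp add: chain_term_def)

text \<open>A new top entry lengthens the chain by one, which flips the sign, and adds one factor
  each to numerator and denominator; \<open>p\<close> is taken at the last entry and does not
  change.\<close>

lemma chain_term_Cons:
  assumes "Ss \<in> type_chains S'"
  shows "chain_term G (S # Ss) = - (real (c S S') / real (c S S)) * chain_term G Ss"
proof -
  obtain q where q: "length Ss = Suc q" and hd: "Ss ! 0 = S'"
    using assms by (cases Ss) (auto simp: type_chains_def)
  show ?thesis
    using q hd by (simp add: chain_term_def prod.lessThan_Suc_shift prod.atMost_Suc_shift
        del: prod.lessThan_Suc prod.atMost_Suc)
qed

text \<open>Finiteness of the set of chains is proved in the same induction, since splitting the sum
  by the second entry of the chain depends on it.\<close>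

lemma num_of_type_eq_sum_chains:
  assumes "simple_graph G" "realizable S"
    and "\<forall>Ss\<in>type_chains S. \<forall>T\<in>set Ss. c_type_invariant T"
  shows "finite (type_chains S) \<and> real (num_of_type G S) = (\<Sum>Ss\<in>type_chains S. chain_term G Ss)"
  using assms(2,3)
proof (induction "size S" arbitrary: S rule: less_induct)
  case less
  let ?L = "{S'. S' \<prec> S}"
  have finL: "finite ?L"
    by (rule finite_subset[OF _ finite_type_le[OF less.prems(1)]]) (auto simp: type_less_def)
  have IH: "finite (type_chains S') \<and>
      real (num_of_type G S') = (\<Sum>Ss\<in>type_chains S'. chain_term G Ss)" if S': "S' \<prec> S" for S'
  proof (rule less.hyps)
    show "size S' < size S" using less.prems(1) S' by (rule type_less_size)
    show "realizable S'" using S' type_le_realizable by (auto simp: type_less_def)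
    show "\<forall>Ss\<in>type_chains S'. \<forall>T\<in>set Ss. c_type_invariant T"
    proof
      fix Ss assume "Ss \<in> type_chains S'"
      then have "S # Ss \<in> type_chains S" using S' type_chains_eq[of S] by blast
      then show "\<forall>T\<in>set Ss. c_type_invariant T" using less.prems(2) by auto
    qed
  qed
  have inv: "c_type_invariant S" using less.prems(2) type_chains_eq[of S] by auto
  have self: "S \<preceq> S"
  proof -
    obtain X :: "nat ugraph" where "simple_graph X" "graph_type X = S"
      using less.prems(1) by (auto simp: realizable_def)
    then show ?thesis using c_graph_self type_leI by metis
  qed
  have fin: "finite (\<Union>S'\<in>?L. (#) S ` type_chains S')" using finL IH by auto
  have "(\<Sum>Ss\<in>type_chains S. chain_term G Ss) =
      chain_term G [S] + (\<Sum>Ss\<in>(\<Union>S'\<in>?L. (#) S ` type_chains S'). chain_term G Ss)"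
    unfolding type_chains_eq[of S] using fin
    by (subst sum.insert) (auto simp: type_chains_def)
  also have "(\<Sum>Ss\<in>(\<Union>S'\<in>?L. (#) S ` type_chains S'). chain_term G Ss) =
      (\<Sum>S'\<in>?L. \<Sum>Ss\<in>(#) S ` type_chains S'. chain_term G Ss)"
    using finL IH by (intro sum.UNION_disjoint) (auto simp: type_chains_def)
  also have "\<dots> = (\<Sum>S'\<in>?L. - (real (c S S') / real (c S S)) * real (num_of_type G S'))"
  proof (rule sum.cong)
    fix S' assume "S' \<in> ?L"
    then show "(\<Sum>Ss\<in>(#) S ` type_chains S'. chain_term G Ss) =
        - (real (c S S') / real (c S S)) * real (num_of_type G S')"
      using IH[of S'] by (simp add: sum.reindex inj_on_def chain_term_Cons sum_distrib_left
          del: mult_minus_left)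
  qed simp
  \<comment> \<open>The right-hand side is the identity of \<open>p_eq_sum_types\<close> solved for
    \<open>num_of_type G S\<close>.\<close>
  also have "chain_term G [S] + \<dots> =
      (real (p G S) - (\<Sum>S'\<in>?L. real (c S S' * num_of_type G S'))) / real (c S S)"
    by (simp add: chain_term_singleton sum_negf sum_divide_distrib diff_divide_distrib)
  also have "p G S = c S S * num_of_type G S + (\<Sum>S'\<in>?L. c S S' * num_of_type G S')"
  proof -
    have "{S'. S' \<preceq> S} = insert S ?L" using self by (auto simp: type_less_def)
    then show ?thesis
      using p_eq_sum_types[OF assms(1) less.prems(1) inv] finL by (simp add: type_less_def)
  qed
  finally have "(\<Sum>Ss\<in>type_chains S. chain_term G Ss) = real (num_of_type G S)"
    using c_self[OF less.prems(1)] by simp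
  then show ?case using fin type_chains_eq[of S] by simp
qed


section \<open>Families without single vertices\<close>

text \<open>An isolated vertex would be all of \<open>H\<close>. Such an \<open>H\<close> is
  recovered from its edges, which lets covers be moved by a map on edges alone.\<close>

lemma nonseparable_Union_edges:
  assumes "simple_graph H" "\<not> separable H" "card (verts H) \<noteq> 1"
  shows "\<Union> (edges H) = verts H"
proof (intro equalityI subsetI)
  fix v assume v: "v \<in> verts H"
  show "v \<in> \<Union> (edges H)"
  proof (rule ccontr)
    assume "v \<notin> \<Union> (edges H)"
    then have "H = ({v}, {})"
      using nonseparable_isolated_vertex[OF assms(1,2) v] by blast
    then show False using assms(3) by simp
  qed
qed (use simple_graph_edgeD(1)[OF assms(1)] in blast)

lemma cover_tuple_Union_edges:
  assumes "Xs \<in> cover_tuples Fs X" "\<And>H. H \<in> set Xs \<Longrightarrow> \<Union> (edges H) = verts H"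
  shows "\<Union> (edges X) = verts X"
proof -
  have "\<Union> (edges (union_graph Xs)) = (\<Union>H\<in>set Xs. \<Union> (edges H))"
    unfolding edges_union_graph by blast
  also have "\<dots> = verts (union_graph Xs)"
    unfolding verts_union_graph using assms(2) by (rule SUP_cong[OF refl])
  finally have "\<Union> (edges (union_graph Xs)) = verts (union_graph Xs)" .
  then show ?thesis using cover_tuplesD(3)[OF assms(1)] by simp
qed

text \<open>Matched elements are removed one pair at a time. For equal types this pairs the blocks
  of one graph with isomorphic blocks of the other.\<close>

lemma image_mset_eq_bij_betw:
  assumes "finite A" "finite B" "image_mset f (mset_set A) = image_mset g (mset_set B)"
  obtains \<beta> where "bij_betw \<beta> A B" "\<And>x. x \<in> A \<Longrightarrow> g (\<beta> x) = f x"
proof -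
  have "\<exists>\<beta>. bij_betw \<beta> A B \<and> (\<forall>x\<in>A. g (\<beta> x) = f x)"
    using assms
  proof (induction A arbitrary: B)
    case empty
    then show ?case by (simp add: mset_set_empty_iff bij_betw_def)
  next
    case (insert a A)
    have "f a \<in># image_mset g (mset_set B)"
      unfolding insert.prems(2)[symmetric] using insert.hyps by simp
    then obtain b where b: "b \<in> B" "g b = f a" using insert.prems(1) by auto
    have "image_mset f (mset_set A) = image_mset g (mset_set (B - {b}))"
      using insert.prems insert.hyps b by (simp add: mset_set.remove[of B b])
    then obtain \<beta> where \<beta>: "bij_betw \<beta> A (B - {b})" "\<forall>x\<in>A. g (\<beta> x) = f x"
      using insert.IH[of "B - {b}"] insert.prems(1) by auto
    have "bij_betw (\<beta>(a := b)) A (B - {b})"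
      using \<beta>(1) insert.hyps(2) by (subst bij_betw_cong[of A _ \<beta>]) auto
    then have "bij_betw (\<beta>(a := b)) (insert a A) B"
      using notIn_Un_bij_betw[of a A "\<beta>(a := b)" "B - {b}"] insert.hyps(2) b(1)
      by (simp add: insert_absorb)
    moreover have "\<forall>x\<in>insert a A. g ((\<beta>(a := b)) x) = f x"
      using \<beta>(2) b(2) insert.hyps(2) by auto
    ultimately show ?case by blast
  qed
  then show thesis using that by blast
qed

text \<open>Isomorphisms between corresponding blocks need not agree at cut vertices, but together they
  induce a bijection of the edges, and a non-separable graph other than a single vertex is
  determined by its edges.\<close>

lemma card_cover_tuples_le:
  fixes X :: "'a ugraph" and X' :: "'b ugraph"
  assumes X: "simple_graph X" and X': "simple_graph X'"
    and type: "graph_type X = graph_type X'"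
    and Fs: "\<And>F. F \<in> set Fs \<Longrightarrow> simple_graph F \<and> \<not> separable F \<and> card (verts F) \<noteq> 1"
  shows "card (cover_tuples Fs X) \<le> card (cover_tuples Fs X')"
proof (cases "cover_tuples Fs X = {}")
  case False
  have memb: "subgraph H X \<and> \<not> separable H \<and> \<Union> (edges H) = verts H"
    if Xs: "Xs \<in> cover_tuples Fs X" "H \<in> set Xs" for Xs H
  proof -
    obtain F where F: "F \<in> set Fs" "isomorphic H F" using Xs by (rule cover_tuples_isomorphic)
    have sub: "subgraph H X" using cover_tuplesD(2)[OF Xs] .
    then have simple: "simple_graph H" by (rule subgraph_simple)
    have ns: "\<not> separable H"
      using F Fs[OF F(1)] simple isomorphic_sym isomorphic_nonseparable by blast
    have "card (verts H) \<noteq> 1" using isomorphic_card_verts[OF F(2)] Fs[OF F(1)] by simp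
    then show ?thesis using nonseparable_Union_edges[OF simple ns] ns sub by simp
  qed
  \<comment> \<open>Holds because some covering tuple exists; a graph with isolated vertices has
    none here.\<close>
  have UX: "\<Union> (edges X) = verts X"
    using False cover_tuple_Union_edges memb by (metis all_not_in_conv)
  obtain \<beta> where \<beta>: "bij_betw \<beta> (blocks X) (blocks X')"
    and cls: "\<And>B. B \<in> blocks X \<Longrightarrow> iso_class (\<beta> B) = iso_class B"
    using image_mset_eq_bij_betw[OF finite_blocks[OF X] finite_blocks[OF X']
      type[unfolded graph_type_def]] by metis
  have \<beta>_block: "\<beta> B \<in> blocks X'" if "B \<in> blocks X" for B
    using that \<beta> by (auto simp: bij_betw_def)
  have \<beta>_surj: "\<beta> ` blocks X = blocks X'" using \<beta> by (simp add: bij_betw_def)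
  have "\<exists>f. inj_on f (verts B) \<and> \<beta> B = map_graph f B" if B: "B \<in> blocks X" for B
    unfolding isomorphic_iff_map_graph[symmetric]
    using cls[OF B] iso_class_eq_iff[OF blockD(3)[OF B] blockD(3)[OF \<beta>_block[OF B]]] by simp
  then obtain f where f: "\<And>B. B \<in> blocks X \<Longrightarrow> inj_on (f B) (verts B)"
    "\<And>B. B \<in> blocks X \<Longrightarrow> \<beta> B = map_graph (f B) B"
    by metis
  obtain blk where blk: "\<And>e. e \<in> edges X \<Longrightarrow> blk e \<in> blocks X \<and> e \<in> edges (blk e)"
  proof -
    have "\<forall>e\<in>edges X. \<exists>B\<in>blocks X. e \<in> edges B" using edge_in_block[OF X] by blast
    then show ?thesis using that by metis
  qed
  have edgesX: "e \<in> edges X" if "B \<in> blocks X" "e \<in> edges B" for B e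
    using blockD(1)[OF that(1)] that(2) by (auto simp: subgraph_def)
  \<comment> \<open>Each edge moves with the isomorphism of the one block that contains it.\<close>
  define \<phi> where "\<phi> e = f (blk e) ` e" for e
  have \<phi>: "\<phi> e = f B ` e" if "B \<in> blocks X" "e \<in> edges B" for B e
    using blocks_eq_if_common_edge[OF X that(1) _ that(2)] blk edgesX[OF that]
    unfolding \<phi>_def by metis
  have \<phi>_edge: "\<phi> e \<in> edges (\<beta> B)" if "B \<in> blocks X" "e \<in> edges B" for B e
    using \<phi>[OF that] f(2)[OF that(1)] that(2) by simp
  have \<phi>_img: "\<phi> ` edges X = edges X'"
  proof (intro equalityI subsetI)
    fix e' assume "e' \<in> \<phi> ` edges X"
    then obtain e where "e \<in> edges X" "e' = \<phi> e" by blast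
    then have "e' \<in> edges (\<beta> (blk e))" "\<beta> (blk e) \<in> blocks X'"
      using blk \<phi>_edge \<beta>_block by blast+
    then show "e' \<in> edges X'" by (metis blockD(1) subgraph_def subsetD)
  next
    fix e' assume "e' \<in> edges X'"
    then obtain B' where "B' \<in> blocks X'" "e' \<in> edges B'" using edge_in_block[OF X'] by blast
    then obtain B where B: "B \<in> blocks X" "e' \<in> edges (\<beta> B)" unfolding \<beta>_surj[symmetric] by blast
    then obtain e where "e \<in> edges B" "e' = f B ` e" using f(2)[OF B(1)] by auto
    then show "e' \<in> \<phi> ` edges X" using \<phi>[OF B(1)] edgesX[OF B(1)] by blast
  qed
  have \<phi>_inj: "inj_on \<phi> (edges X)"
  proof (rule inj_onI)
    fix e1 e2 assume e: "e1 \<in> edges X" "e2 \<in> edges X" and eq: "\<phi> e1 = \<phi> e2"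
    let ?B = "blk e1"
    have B: "?B \<in> blocks X" "blk e2 \<in> blocks X" using blk e by blast+
    have "\<phi> e1 \<in> edges (\<beta> ?B)" "\<phi> e1 \<in> edges (\<beta> (blk e2))"
      using blk e eq \<phi>_edge by metis+
    then have "\<beta> ?B = \<beta> (blk e2)"
      using blocks_eq_if_common_edge[OF X'] \<beta>_block B by blast
    then have "blk e2 = ?B" using \<beta> B by (auto simp: bij_betw_def inj_on_def)
    then have "e1 \<in> edges ?B" "e2 \<in> edges ?B" using blk e by metis+
    moreover have "f ?B ` e1 = f ?B ` e2" using eq \<phi>[OF B(1)] calculation by metis
    ultimately show "e1 = e2"
      using f(1)[OF B(1)] simple_graph_edgeD(1)[OF blockD(3)[OF B(1)]]
      by (metis inj_on_image_eq_iff)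
  qed
  \<comment> \<open>A vertex of \<open>X'\<close> lies in some \<open>\<beta> B\<close>, and its
    preimage in \<open>B\<close> is an end of an edge. So a moved tuple covers \<open>X'\<close> as
    soon as it covers the edges.\<close>
  have UX': "\<Union> (edges X') = verts X'"
  proof (intro equalityI subsetI)
    fix v assume "v \<in> verts X'"
    then obtain B' where "B' \<in> blocks X'" "v \<in> verts B'" using vertex_in_block[OF X'] by blast
    then obtain B where B: "B \<in> blocks X" "v \<in> verts (\<beta> B)" unfolding \<beta>_surj[symmetric] by blast
    then obtain u where "u \<in> verts B" "v = f B u" using f(2)[OF B(1)] by auto
    then obtain e where "e \<in> edges B" "v \<in> f B ` e"
      using verts_block_eq_Union_edges[OF X UX B(1)] by blast
    then show "v \<in> \<Union> (edges X')"
      using \<phi>[OF B(1)] edgesX[OF B(1)] \<phi>_img by blast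
  qed (use simple_graph_edgeD(1)[OF X'] in blast)
  define \<Phi> where "\<Phi> H = (\<Union> (\<phi> ` edges H), \<phi> ` edges H)" for H :: "'a ugraph"
  have \<Phi>: "subgraph (\<Phi> H) X' \<and> (isomorphic H F \<longrightarrow> isomorphic (\<Phi> H) F)"
    if H: "subgraph H X" "\<not> separable H" "\<Union> (edges H) = verts H" for H and F :: "'c ugraph"
  proof -
    \<comment> \<open>A non-separable \<open>H\<close> stays within one block, where
      \<open>\<Phi>\<close> acts as the graph map given by \<open>f B\<close>.\<close>
    obtain B where B: "B \<in> blocks X" "subgraph H B" using block_containing[OF X H(1,2)] .
    have "\<phi> ` edges H = (\<lambda>e. f B ` e) ` edges H"
      using \<phi>[OF B(1)] B(2) by (intro image_cong refl) (auto simp: subgraph_def)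
    then have eq: "\<Phi> H = map_graph (f B) H"
      unfolding \<Phi>_def map_graph_def H(3)[symmetric] by (simp add: image_Union)
    have "subgraph (\<Phi> H) (\<beta> B)"
      unfolding eq f(2)[OF B(1)] using B(2) f(1)[OF B(1)] by (rule subgraph_map_graph)
    then have "subgraph (\<Phi> H) X'" using blockD(1)[OF \<beta>_block[OF B(1)]] subgraph_trans by blast
    then show ?thesis
      using isomorphic_map_graph_iff[OF B(2) f(1)[OF B(1)], of F] unfolding eq by simp
  qed
  have "map \<Phi> Xs \<in> cover_tuples Fs X'" if Xs: "Xs \<in> cover_tuples Fs X" for Xs
  proof -
    have E: "(\<Union>H\<in>set Xs. edges H) = edges X"
      using cover_tuplesD(3)[OF Xs] edges_union_graph[of Xs] by simp
    have "edges (union_graph (map \<Phi> Xs)) = \<phi> ` (\<Union>H\<in>set Xs. edges H)"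
      by (simp add: edges_union_graph \<Phi>_def image_UN)
    then have edges: "edges (union_graph (map \<Phi> Xs)) = edges X'" unfolding E \<phi>_img .
    have "verts (union_graph (map \<Phi> Xs)) = \<Union> (edges (union_graph (map \<Phi> Xs)))"
      by (simp add: edges_union_graph verts_union_graph \<Phi>_def) blast
    then have "union_graph (map \<Phi> Xs) = X'" using edges UX' by (simp add: prod_eq_iff)
    moreover have "list_all2 (\<lambda>H F. subgraph H X' \<and> isomorphic H F) (map \<Phi> Xs) Fs"
      using Xs \<Phi> memb[OF Xs] unfolding cover_tuples_def list_all2_conv_all_nth
      by (auto simp del: split_paired_All split_paired_Ex)
    ultimately show ?thesis by (simp add: cover_tuples_def)
  qed
  moreover have "inj_on (map \<Phi>) (cover_tuples Fs X)"
  proof (rule inj_on_subset)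
    have "inj_on \<Phi> {H. subgraph H X \<and> \<Union> (edges H) = verts H}"
    proof (rule inj_onI)
      fix H K assume H: "H \<in> {H. subgraph H X \<and> \<Union> (edges H) = verts H}"
        and K: "K \<in> {H. subgraph H X \<and> \<Union> (edges H) = verts H}" and "\<Phi> H = \<Phi> K"
      then have "\<phi> ` edges H = \<phi> ` edges K" by (simp add: \<Phi>_def)
      then have "edges H = edges K"
        using H K \<phi>_inj by (auto simp: subgraph_def inj_on_image_eq_iff)
      moreover have "verts H = \<Union> (edges H)" "verts K = \<Union> (edges K)" using H K by simp_all
      ultimately show "H = K" by (simp add: prod_eq_iff)
    qed
    then show "inj_on (map \<Phi>) (lists {H. subgraph H X \<and> \<Union> (edges H) = verts H})"
      by (rule inj_on_map_lists)
    show "cover_tuples Fs X \<subseteq> lists {H. subgraph H X \<and> \<Union> (edges H) = verts H}"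
      unfolding lists_eq_set using memb by blast
  qed
  ultimately show ?thesis
    using finite_cover_tuples[OF X', of Fs] card_inj_on_le[of "map \<Phi>"]
    by (simp add: image_subset_iff)
qed simp

text \<open>Stated for classes rather than for a family, because chains run through types. Comparing
  with 1 excludes the single vertex but admits the graph without vertices.\<close>

definition vertex_free :: "gtype \<Rightarrow> bool" where
  "vertex_free S \<longleftrightarrow> (\<forall>K\<in>#S. \<forall>H\<in>K. card (verts H) \<noteq> 1)"

lemma vertex_free_repr_family:
  assumes "realizable S" "vertex_free S" "F \<in> set (repr_family S)"
  shows "card (verts F) \<noteq> 1"
proof -
  have "iso_class F \<in># family_type (repr_family S)" using assms(3) by (simp add: family_type_def)
  moreover have "F \<in> iso_class F"
    using repr_family(2)[OF assms(1,3)] by (simp add: iso_class_def isomorphic_refl)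
  ultimately show ?thesis using assms(1,2) by (auto simp: vertex_free_def repr_family(1))
qed

text \<open>The inequality \<open>card_cover_tuples_le\<close> applies in both directions.\<close>

lemma c_type_invariant_vertex_free:
  assumes "realizable S" "vertex_free S"
  shows "c_type_invariant S"
  unfolding c_type_invariant_def c_graph_def
  using card_cover_tuples_le[of _ _ "repr_family S"] repr_family(2,3)[OF assms(1)]
    vertex_free_repr_family[OF assms]
  by (metis order_antisym)

text \<open>A union of graphs without isolated vertices has none either, so none of its blocks is a
  single vertex.\<close>

lemma vertex_free_type_le:
  assumes "realizable S" "vertex_free S" "S' \<preceq> S"
  shows "vertex_free S'"
proof -
  obtain X :: "nat ugraph" and Xs where X: "simple_graph X" "graph_type X = S'"
    and Xs: "Xs \<in> cover_tuples (repr_family S) X"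
    using assms(3) by (rule type_leE)
  have "\<Union> (edges H) = verts H" if "H \<in> set Xs" for H
  proof -
    obtain F where F: "F \<in> set (repr_family S)" "isomorphic H F"
      using Xs \<open>H \<in> set Xs\<close> by (rule cover_tuples_isomorphic)
    show ?thesis
      using cover_tuplesD(2)[OF Xs that] cover_tuple_nonseparable[OF assms(1) Xs that]
        isomorphic_card_verts[OF F(2)] vertex_free_repr_family[OF assms(1,2) F(1)]
      by (intro nonseparable_Union_edges) (simp_all add: subgraph_simple)
  qed
  with Xs have UX: "\<Union> (edges X) = verts X" by (rule cover_tuple_Union_edges)
  have B1: "card (verts B) \<noteq> 1" if B: "B \<in> blocks X" for B
  proof
    assume "card (verts B) = 1"
    then obtain v where v: "verts B = {v}" by (meson card_1_singletonE)
    then obtain e where e: "e \<in> edges B"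
      using verts_block_eq_Union_edges[OF X(1) UX B] by blast
    then show False
      using simple_graph_edgeD[OF blockD(3)[OF B] e] v card_mono[of "{v}" e] by simp
  qed
  have "card (verts H) \<noteq> 1" if K: "K \<in># S'" "H \<in> K" for K H
  proof -
    obtain B where "B \<in> blocks X" "K = iso_class B"
      using K(1) X(2) finite_blocks[OF X(1)] unfolding graph_type_def by fastforce
    then show ?thesis using K(2) B1 isomorphic_card_verts[of H B] by (simp add: iso_class_def)
  qed
  then show ?thesis unfolding vertex_free_def by blast
qed

lemma vertex_free_chain:
  assumes "realizable S" "vertex_free S" "Ss \<in> type_chains S" "T \<in> set Ss"
  shows "realizable T \<and> vertex_free T"
  using assms
proof (induction Ss arbitrary: S)
  case (Cons U Us)
  from Cons.prems(3) consider "U = S" "Us = []"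
    | S' where "U = S" "S' \<prec> S" "Us \<in> type_chains S'"
    unfolding type_chains_eq[of S] by blast
  then show ?case
  proof cases
    case (2 S')
    have "S' \<preceq> S" using 2(2) by (simp add: type_less_def)
    then show ?thesis
      using Cons.IH[OF _ _ 2(3)] Cons.prems type_le_realizable vertex_free_type_le 2(1) by auto
  qed (use Cons.prems in auto)
qed simp

lemma vertex_free_family_type:
  assumes "\<And>F. F \<in> set Fs \<Longrightarrow> card (verts F) \<noteq> 1"
  shows "vertex_free (family_type Fs)"
  using assms isomorphic_card_verts
  by (fastforce simp: vertex_free_def family_type_def iso_class_def)

theorem theorem5p1:
  fixes G :: "'a ugraph" and Fs :: "'b ugraph list" and S0 :: gtype
  assumes "simple_graph G"
    and "\<And>F. F \<in> set Fs \<Longrightarrow> simple_graph F \<and> \<not> separable F"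
    and "S0 = family_type Fs"
    and "(\<forall>F\<in>set Fs. card (verts F) \<noteq> 1) \<or>
         (\<forall>Ss\<in>type_chains S0. \<forall>S\<in>set Ss. c_type_invariant S)"
  shows "real (num_of_type G S0) = (\<Sum>Ss\<in>type_chains S0. chain_term G Ss)"
proof (cases "realizable S0")
  case True
  have "\<forall>Ss\<in>type_chains S0. \<forall>S\<in>set Ss. c_type_invariant S"
    using assms(4)
  proof
    assume "\<forall>F\<in>set Fs. card (verts F) \<noteq> 1"
    then have "vertex_free S0" using assms(3) vertex_free_family_type by blast
    then show ?thesis using vertex_free_chain[OF True] c_type_invariant_vertex_free by blast
  qed
  then show ?thesis using num_of_type_eq_sum_chains[OF assms(1) True] by blast
next
  case False
  have "{H. subgraph H G \<and> graph_type H = S0} = {}"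
    using False realizable_graph_type subgraph_simple by blast
  then have "num_of_type G S0 = 0" unfolding num_of_type_def by (metis card.empty)
  moreover have "chain_term G Ss = 0" if "Ss \<in> type_chains S0" for Ss
  proof -
    \<comment> \<open>The factor \<open>c S0 S0 = 0\<close> in the denominator makes the quotient 0.\<close>
    have "Ss ! 0 = S0" using that by (simp add: type_chains_def)
    then have "(\<Prod>i\<le>length Ss - 1. real (c (Ss ! i) (Ss ! i))) = 0"
      using c_eq_0[OF False] by (intro prod_zero) (auto intro!: bexI[of _ 0])
    then show ?thesis unfolding chain_term_def Let_def by (simp only: div_by_0)
  qed
  \<comment> \<open>All terms vanish, so the sum is 0 whether or not the set of chains is
    finite.\<close>
  ultimately show ?thesis by simp
qed

end
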